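(* Let $L=\{<,\ldots\}$ be a countable first order language containing a binary relation symbol $<$, and let $T$ be a complete $L$-theory with Skolem functions in which $<$ is interpreted as a linear order. Suppose $T$ satisfies the inaccessibility scheme. Let $M$ be a model of $T$ with $cof(M)=\omega$. Then $M$ has an elementary end extension $N$ such that $|N|=|M|$ and $cof(N)=\omega$.
   Context: For a formula $\varphi(\bar{x},\bar{t})$ and tuples $\bar{y}_0,\bar{y}_1$ of the same length as $\bar{x}$, write $E_{\varphi}(\bar{y}_0,\bar{y}_1;z_0)$ for the formula $(\forall \bar{t}<z_0)(\varphi(\bar{y}_0,\bar{t})\leftrightarrow\varphi(\bar{y}_1,\bar{t}))$; here $\bar{t}<z_0$ means every coordinate of $\bar{t}$ is $<z_0$. $T$ satisfies the inaccessibility scheme if for every formula $\varphi(\bar{x},\bar{t})$ of $L$ (with $\bar{x}$ a tuple of any finite length), $T\models (\forall z_0)(\exists z_1>z_0)(\forall\bar{y}_0)(\exists\bar{y}_1<z_1)E_{\varphi}(\bar{y}_0,\bar{y}_1;z_0)$. "$T$ has Skolem functions" means that for every formula $\theta(y,\bar{x})$ there is a term $\tau(\bar{x})$ of $L$ with $T\models \forall\bar{x}(\exists y\,\theta(y,\bar{x})\to\theta(\tau(\bar{x}),\bar{x}))$. For a regular cardinal $\kappa$, $cof(M)=\kappa$ means $\kappa$ is the least cardinal such that there is a strictly increasing sequence of length $\kappa$ cofinal in $(M,<)$. $N$ is an elementary end extension of $M$ if $M\preceq N$ and every element of $N$ that is $<$ some element of $M$ belongs to $M$. $|M|$ denotes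 the cardinality of $M$. *)

theory Defs
  imports Main "HOL-Library.Equipollence" "HOL-Library.Countable_Set"
begin

text \<open>A first-order language is given by a type of function symbols 'f with an
arity map, and a type of relation symbols 'p with an arity map.  Constants are
0-ary function symbols.  Variables are natural numbers.\<close>

datatype 'f trm = Var nat | Fn 'f "'f trm list"

datatype ('f, 'p) fm =
    Eq "'f trm" "'f trm"
  | Rel 'p "'f trm list"
  | Neg "('f, 'p) fm"
  | Conj "('f, 'p) fm" "('f, 'p) fm"
  | Ex nat "('f, 'p) fm"

fun wf_trm :: "('f \<Rightarrow> nat) \<Rightarrow> 'f trm \<Rightarrow> bool" where
  "wf_trm fa (Var v) = True"
| "wf_trm fa (Fn f ts) = (length ts = fa f \<and> (\<forall>t\<in>set ts. wf_trm fa t))"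

fun wf_fm :: "('f \<Rightarrow> nat) \<Rightarrow> ('p \<Rightarrow> nat) \<Rightarrow> ('f, 'p) fm \<Rightarrow> bool" where
  "wf_fm fa pa (Eq s t) = (wf_trm fa s \<and> wf_trm fa t)"
| "wf_fm fa pa (Rel p ts) = (length ts = pa p \<and> (\<forall>t\<in>set ts. wf_trm fa t))"
| "wf_fm fa pa (Neg \<phi>) = wf_fm fa pa \<phi>"
| "wf_fm fa pa (Conj \<phi> \<psi>) = (wf_fm fa pa \<phi> \<and> wf_fm fa pa \<psi>)"
| "wf_fm fa pa (Ex v \<phi>) = wf_fm fa pa \<phi>"

fun vars_trm :: "'f trm \<Rightarrow> nat set" where
  "vars_trm (Var v) = {v}"
| "vars_trm (Fn f ts) = (\<Union>t\<in>set ts. vars_trm t)"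

fun fv :: "('f, 'p) fm \<Rightarrow> nat set" where
  "fv (Eq s t) = vars_trm s \<union> vars_trm t"
| "fv (Rel p ts) = (\<Union>t\<in>set ts. vars_trm t)"
| "fv (Neg \<phi>) = fv \<phi>"
| "fv (Conj \<phi> \<psi>) = fv \<phi> \<union> fv \<psi>"
| "fv (Ex v \<phi>) = fv \<phi> - {v}"

definition sentence :: "('f \<Rightarrow> nat) \<Rightarrow> ('p \<Rightarrow> nat) \<Rightarrow> ('f, 'p) fm \<Rightarrow> bool" where
  "sentence fa pa \<phi> \<longleftrightarrow> wf_fm fa pa \<phi> \<and> fv \<phi> = {}"

record ('a, 'f, 'p) struc =
  univ :: "'a set"
  fint :: "'f \<Rightarrow> 'a list \<Rightarrow> 'a"
  rint :: "'p \<Rightarrow> 'a list \<Rightarrow> bool"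

definition is_struc :: "('f \<Rightarrow> nat) \<Rightarrow> ('a, 'f, 'p) struc \<Rightarrow> bool" where
  "is_struc fa S \<longleftrightarrow> univ S \<noteq> {} \<and>
     (\<forall>f as. length as = fa f \<longrightarrow> set as \<subseteq> univ S \<longrightarrow> fint S f as \<in> univ S)"

fun eval :: "('a, 'f, 'p) struc \<Rightarrow> (nat \<Rightarrow> 'a) \<Rightarrow> 'f trm \<Rightarrow> 'a" where
  "eval S e (Var v) = e v"
| "eval S e (Fn f ts) = fint S f (map (eval S e) ts)"

fun sat :: "('a, 'f, 'p) struc \<Rightarrow> (nat \<Rightarrow> 'a) \<Rightarrow> ('f, 'p) fm \<Rightarrow> bool" where
  "sat S e (Eq s t) = (eval S e s = eval S e t)"
| "sat S e (Rel p ts) = rint S p (map (eval S e) ts)"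
| "sat S e (Neg \<phi>) = (\<not> sat S e \<phi>)"
| "sat S e (Conj \<phi> \<psi>) = (sat S e \<phi> \<and> sat S e \<psi>)"
| "sat S e (Ex v \<phi>) = (\<exists>a\<in>univ S. sat S (e(v := a)) \<phi>)"

definition asg :: "('a, 'f, 'p) struc \<Rightarrow> (nat \<Rightarrow> 'a) \<Rightarrow> bool" where
  "asg S e \<longleftrightarrow> (\<forall>v. e v \<in> univ S)"

fun updl :: "(nat \<Rightarrow> 'a) \<Rightarrow> nat list \<Rightarrow> 'a list \<Rightarrow> (nat \<Rightarrow> 'a)" where
  "updl e (x # xs) (a # as) = (updl e xs as)(x := a)"
| "updl e _ _ = e"

definition holds :: "('a, 'f, 'p) struc \<Rightarrow> ('f, 'p) fm \<Rightarrow> bool" where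
  "holds S \<phi> \<longleftrightarrow> (\<forall>e. asg S e \<longrightarrow> sat S e \<phi>)"

definition is_model :: "('f \<Rightarrow> nat) \<Rightarrow> ('p \<Rightarrow> nat) \<Rightarrow> ('a, 'f, 'p) struc \<Rightarrow> ('f, 'p) fm set \<Rightarrow> bool" where
  "is_model fa pa S T \<longleftrightarrow> is_struc fa S \<and> (\<forall>\<phi>\<in>T. holds S \<phi>)"

definition entails :: "'a itself \<Rightarrow> ('f \<Rightarrow> nat) \<Rightarrow> ('p \<Rightarrow> nat) \<Rightarrow> ('f, 'p) fm set \<Rightarrow> (('a, 'f, 'p) struc \<Rightarrow> bool) \<Rightarrow> bool" where
  "entails _ fa pa T P \<longleftrightarrow> (\<forall>S :: ('a, 'f, 'p) struc. is_model fa pa S T \<longrightarrow> P S)"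

definition is_theory :: "('f \<Rightarrow> nat) \<Rightarrow> ('p \<Rightarrow> nat) \<Rightarrow> ('f, 'p) fm set \<Rightarrow> bool" where
  "is_theory fa pa T \<longleftrightarrow> (\<forall>\<phi>\<in>T. sentence fa pa \<phi>)"

definition complete_theory :: "'a itself \<Rightarrow> ('f \<Rightarrow> nat) \<Rightarrow> ('p \<Rightarrow> nat) \<Rightarrow> ('f, 'p) fm set \<Rightarrow> bool" where
  "complete_theory A fa pa T \<longleftrightarrow> is_theory fa pa T \<and>
     (\<exists>S :: ('a, 'f, 'p) struc. is_model fa pa S T) \<and>
     (\<forall>\<phi>. sentence fa pa \<phi> \<longrightarrow>
        entails A fa pa T (\<lambda>S. holds S \<phi>) \<or> entails A fa pa T (\<lambda>S. holds S (Neg \<phi>)))"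

definition less :: "'p \<Rightarrow> ('a, 'f, 'p) struc \<Rightarrow> 'a \<Rightarrow> 'a \<Rightarrow> bool" where
  "less lt S a b \<longleftrightarrow> rint S lt [a, b]"

definition linear_order_in :: "'p \<Rightarrow> ('a, 'f, 'p) struc \<Rightarrow> bool" where
  "linear_order_in lt S \<longleftrightarrow>
     (\<forall>a\<in>univ S. \<not> less lt S a a) \<and>
     (\<forall>a\<in>univ S. \<forall>b\<in>univ S. \<forall>c\<in>univ S. less lt S a b \<longrightarrow> less lt S b c \<longrightarrow> less lt S a c) \<and>
     (\<forall>a\<in>univ S. \<forall>b\<in>univ S. less lt S a b \<or> a = b \<or> less lt S b a)"

text \<open>For every formula theta(y, xs) there is a term tau(xs) with
  T |= forall xs (exists y theta -> theta(tau(xs), xs)).  The substitution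
  theta(tau(xs), xs) is expressed semantically by updating y to the value of tau.\<close>
definition has_skolem_functions :: "'a itself \<Rightarrow> ('f \<Rightarrow> nat) \<Rightarrow> ('p \<Rightarrow> nat) \<Rightarrow> ('f, 'p) fm set \<Rightarrow> bool" where
  "has_skolem_functions A fa pa T \<longleftrightarrow>
     (\<forall>\<theta> y xs. wf_fm fa pa \<theta> \<and> distinct (y # xs) \<and> fv \<theta> \<subseteq> insert y (set xs) \<longrightarrow>
        (\<exists>\<tau>. wf_trm fa \<tau> \<and> vars_trm \<tau> \<subseteq> set xs \<and>
           entails A fa pa T (\<lambda>S. \<forall>e. asg S e \<longrightarrow>
              (\<exists>a\<in>univ S. sat S (e(y := a)) \<theta>) \<longrightarrow> sat S (e(y := eval S e \<tau>)) \<theta>)))"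

definition all_below :: "'p \<Rightarrow> ('a, 'f, 'p) struc \<Rightarrow> 'a list \<Rightarrow> 'a \<Rightarrow> bool" where
  "all_below lt S as z \<longleftrightarrow> (\<forall>a\<in>set as. less lt S a z)"

definition tuple :: "('a, 'f, 'p) struc \<Rightarrow> nat \<Rightarrow> 'a list \<Rightarrow> bool" where
  "tuple S n as \<longleftrightarrow> length as = n \<and> set as \<subseteq> univ S"

definition inaccessibility_scheme :: "'a itself \<Rightarrow> ('f \<Rightarrow> nat) \<Rightarrow> ('p \<Rightarrow> nat) \<Rightarrow> 'p \<Rightarrow> ('f, 'p) fm set \<Rightarrow> bool" where
  "inaccessibility_scheme A fa pa lt T \<longleftrightarrow>
     (\<forall>\<phi> xs ts. wf_fm fa pa \<phi> \<and> distinct (xs @ ts) \<and> fv \<phi> \<subseteq> set xs \<union> set ts \<longrightarrow>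
        entails A fa pa T (\<lambda>S. \<forall>e. asg S e \<longrightarrow>
          (\<forall>z0\<in>univ S. \<exists>z1\<in>univ S. less lt S z0 z1 \<and>
             (\<forall>y0. tuple S (length xs) y0 \<longrightarrow>
                (\<exists>y1. tuple S (length xs) y1 \<and> all_below lt S y1 z1 \<and>
                   (\<forall>t. tuple S (length ts) t \<longrightarrow> all_below lt S t z0 \<longrightarrow>
                      (sat S (updl e (xs @ ts) (y0 @ t)) \<phi> \<longleftrightarrow>
                       sat S (updl e (xs @ ts) (y1 @ t)) \<phi>)))))))"

definition cofinal_seq :: "'p \<Rightarrow> ('a, 'f, 'p) struc \<Rightarrow> 'i set \<Rightarrow> ('i::linorder \<Rightarrow> 'a) \<Rightarrow> bool" where
  "cofinal_seq lt S I s \<longleftrightarrow> (\<forall>i\<in>I. s i \<in> univ S) \<and>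
     (\<forall>i\<in>I. \<forall>j\<in>I. i < j \<longrightarrow> less lt S (s i) (s j)) \<and>
     (\<forall>a\<in>univ S. \<exists>i\<in>I. less lt S a (s i) \<or> a = s i)"

text \<open>cof(M) = omega: omega is the least cardinal kappa such that there is a strictly
increasing cofinal sequence of length kappa (all smaller cardinals are finite).\<close>
definition cof_omega :: "'p \<Rightarrow> ('a, 'f, 'p) struc \<Rightarrow> bool" where
  "cof_omega lt S \<longleftrightarrow> (\<exists>s :: nat \<Rightarrow> 'a. cofinal_seq lt S UNIV s) \<and>
     (\<forall>n::nat. \<not> (\<exists>s :: nat \<Rightarrow> 'a. cofinal_seq lt S {..<n} s))"

definition elem_embedding :: "('f \<Rightarrow> nat) \<Rightarrow> ('p \<Rightarrow> nat) \<Rightarrow> ('a \<Rightarrow> 'b) \<Rightarrow> ('a, 'f, 'p) struc \<Rightarrow> ('b, 'f, 'p) struc \<Rightarrow> bool" where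
  "elem_embedding fa pa h M N \<longleftrightarrow> h ` univ M \<subseteq> univ N \<and>
     (\<forall>\<phi> e. wf_fm fa pa \<phi> \<longrightarrow> asg M e \<longrightarrow> (sat M e \<phi> \<longleftrightarrow> sat N (h \<circ> e) \<phi>))"

definition elem_end_extension :: "('f \<Rightarrow> nat) \<Rightarrow> ('p \<Rightarrow> nat) \<Rightarrow> 'p \<Rightarrow> ('a \<Rightarrow> 'b) \<Rightarrow> ('a, 'f, 'p) struc \<Rightarrow> ('b, 'f, 'p) struc \<Rightarrow> bool" where
  "elem_end_extension fa pa lt h M N \<longleftrightarrow> elem_embedding fa pa h M N \<and>
     (\<forall>b\<in>univ N. \<forall>a\<in>univ M. less lt N b (h a) \<longrightarrow> b \<in> h ` univ M) \<and>
     h ` univ M \<noteq> univ N"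

end

theory Submission
  imports Defs "HOL-Library.Countable"
begin

text \<open>The extension is a definable ultrapower of \<open>M\<close>. Let \<open>a n\<close> be cofinal in \<open>M\<close>. The scheme implies
  that a decreasing definable family of bounded sets stabilizes, and hence that, for a formula
  \<open>\<phi>(x, t)\<close> and a bound \<open>z\<close>, all sufficiently large \<open>y\<close> lie in unbounded classes of
  \<open>E\<^sub>\<phi>(_, _; z)\<close>. Applied to the first \<open>n\<close> formulas jointly with \<open>z = a n\<close>, this yields a descending
  sequence of unbounded classes \<open>C n\<close>, which generate an ultrafilter on the definable subsets of \<open>M\<close>.
  A definable function whose values are eventually below an element of \<open>M\<close> is constant on some \<open>C n\<close>,
  so the ultrapower by definable functions is an end extension; the identity function represents a
  new element. Stabilization also gives collection, so for each of the countably many terms \<open>\<tau>\<close> and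
  each \<open>n\<close> the values \<open>\<tau>(x, m)\<close> with \<open>m < a n\<close> have a definable bound; these countably many bounds are
  cofinal in the ultrapower.\<close>

section \<open>Formulas, variables and cardinalities\<close>

lemma finite_vars_trm: "finite (vars_trm t)"
  by (induction t) auto

lemma finite_fv: "finite (fv \<phi>)"
  by (induction \<phi>) (auto simp: finite_vars_trm)

lemma eval_cong: "(\<And>v. v \<in> vars_trm t \<Longrightarrow> e v = e' v) \<Longrightarrow> eval S e t = eval S e' t"
proof (induction t)
  case (Fn f ts)
  then have "map (eval S e) ts = map (eval S e') ts" by auto
  then show ?case by (simp only: eval.simps)
qed simp

lemma sat_cong: "(\<And>v. v \<in> fv \<phi> \<Longrightarrow> e v = e' v) \<Longrightarrow> sat S e \<phi> = sat S e' \<phi>"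
proof (induction \<phi> arbitrary: e e')
  case (Eq s t)
  then show ?case using eval_cong[of s e e' S] eval_cong[of t e e' S] by simp
next
  case (Rel p ts)
  then have "map (eval S e) ts = map (eval S e') ts" by (auto intro!: eval_cong)
  then show ?case by (simp only: sat.simps)
next
  case (Conj \<phi> \<psi>)
  have "sat S e \<phi> = sat S e' \<phi>" by (rule Conj.IH(1)) (simp add: Conj.prems)
  moreover have "sat S e \<psi> = sat S e' \<psi>" by (rule Conj.IH(2)) (simp add: Conj.prems)
  ultimately show ?case by simp
next
  case (Ex v \<phi>)
  have "sat S (e(v := a)) \<phi> = sat S (e'(v := a)) \<phi>" for a
    by (rule Ex.IH) (simp add: Ex.prems)
  then show ?case by simp
next
  case (Neg \<phi>)
  have "sat S e \<phi> = sat S e' \<phi>" by (rule Neg.IH) (simp add: Neg.prems)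
  then show ?case by simp
qed

lemma eval_in_univ:
  assumes "is_struc fa S" "wf_trm fa t" "\<And>v. e v \<in> univ S"
  shows "eval S e t \<in> univ S"
  using assms by (induction t) (auto simp: is_struc_def image_subset_iff)

lemma asg_upd: "asg S e \<Longrightarrow> a \<in> univ S \<Longrightarrow> asg S (e(v := a))"
  by (simp add: asg_def)

section \<open>Term substitution, derived connectives and bounded quantification\<close>

fun subst_trm :: "(nat \<Rightarrow> 'f trm) \<Rightarrow> 'f trm \<Rightarrow> 'f trm" where
  "subst_trm \<sigma> (Var v) = \<sigma> v"
| "subst_trm \<sigma> (Fn f ts) = Fn f (map (subst_trm \<sigma>) ts)"

lemma eval_subst_trm: "eval S e (subst_trm \<sigma> t) = eval S (\<lambda>v. eval S e (\<sigma> v)) t"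
  by (induction t) (auto simp: comp_def cong: map_cong)

lemma wf_subst_trm: "wf_trm fa t \<Longrightarrow> (\<And>v. wf_trm fa (\<sigma> v)) \<Longrightarrow> wf_trm fa (subst_trm \<sigma> t)"
  by (induction t) auto

definition Or :: "('f, 'p) fm \<Rightarrow> ('f, 'p) fm \<Rightarrow> ('f, 'p) fm" where
  "Or \<phi> \<psi> = Neg (Conj (Neg \<phi>) (Neg \<psi>))"

definition Iff :: "('f, 'p) fm \<Rightarrow> ('f, 'p) fm \<Rightarrow> ('f, 'p) fm" where
  "Iff \<phi> \<psi> = Conj (Or (Neg \<phi>) \<psi>) (Or (Neg \<psi>) \<phi>)"

lemma Or_simps [simp]:
  "sat S e (Or \<phi> \<psi>) \<longleftrightarrow> sat S e \<phi> \<or> sat S e \<psi>"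
  "wf_fm fa pa (Or \<phi> \<psi>) \<longleftrightarrow> wf_fm fa pa \<phi> \<and> wf_fm fa pa \<psi>"
  "fv (Or \<phi> \<psi>) = fv \<phi> \<union> fv \<psi>"
  by (auto simp: Or_def)

lemma Iff_simps [simp]:
  "sat S e (Iff \<phi> \<psi>) \<longleftrightarrow> (sat S e \<phi> \<longleftrightarrow> sat S e \<psi>)"
  "wf_fm fa pa (Iff \<phi> \<psi>) \<longleftrightarrow> wf_fm fa pa \<phi> \<and> wf_fm fa pa \<psi>"
  "fv (Iff \<phi> \<psi>) = fv \<phi> \<union> fv \<psi>"
  by (auto simp: Iff_def)

text \<open>Substitution of a variable by way of a quantifier: \<open>y\<close> is read outside
  \<open>\<phi>\<close>, so no bound variable of \<open>\<phi>\<close> can capture it.\<close>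

definition Inst :: "nat \<Rightarrow> nat \<Rightarrow> ('f, 'p) fm \<Rightarrow> ('f, 'p) fm" where
  "Inst x y \<phi> = Ex x (Conj (Eq (Var x) (Var y)) \<phi>)"

lemma sat_Inst: "y \<noteq> x \<Longrightarrow> e y \<in> univ S \<Longrightarrow> sat S e (Inst x y \<phi>) \<longleftrightarrow> sat S (e(x := e y)) \<phi>"
  by (auto simp: Inst_def)

lemma wf_Inst [simp]: "wf_fm fa pa (Inst x y \<phi>) \<longleftrightarrow> wf_fm fa pa \<phi>"
  by (simp add: Inst_def)

lemma fv_Inst: "fv (Inst x y \<phi>) \<subseteq> insert y (fv \<phi> - {x})"
  by (auto simp: Inst_def)

fun Ball_below :: "'p \<Rightarrow> nat list \<Rightarrow> nat \<Rightarrow> ('f, 'p) fm \<Rightarrow> ('f, 'p) fm" where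
  "Ball_below lt [] z \<phi> = \<phi>"
| "Ball_below lt (t # ts) z \<phi> =
    Neg (Ex t (Conj (Rel lt [Var t, Var z]) (Neg (Ball_below lt ts z \<phi>))))"

lemma wf_Ball_below: "pa lt = 2 \<Longrightarrow> wf_fm fa pa \<phi> \<Longrightarrow> wf_fm fa pa (Ball_below lt ts z \<phi>)"
  by (induction ts) auto

lemma fv_Ball_below: "fv (Ball_below lt ts z \<phi>) \<subseteq> insert z (fv \<phi> - set ts)"
  by (induction ts) auto

text \<open>Speaking of assignments that agree with \<open>e\<close> off \<open>ts\<close>, instead
  of tuples, lets later arguments treat bounded parameters without indices.\<close>

lemma sat_Ball_below:
  assumes "z \<notin> set ts" "asg S e"
  shows "sat S e (Ball_below lt ts z \<phi>) \<longleftrightarrow>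
    (\<forall>e'. asg S e' \<longrightarrow> (\<forall>v. v \<notin> set ts \<longrightarrow> e' v = e v) \<longrightarrow>
      (\<forall>v\<in>set ts. less lt S (e' v) (e z)) \<longrightarrow> sat S e' \<phi>)"
  using assms
proof (induction ts arbitrary: e)
  case Nil
  have "e' = e" if "\<forall>v. e' v = e v" for e' using that by auto
  then show ?case using Nil by auto
next
  case (Cons t ts)
  have IH: "sat S (e(t := a)) (Ball_below lt ts z \<phi>) \<longleftrightarrow>
    (\<forall>e'. asg S e' \<longrightarrow> (\<forall>v. v \<notin> set ts \<longrightarrow> e' v = (e(t := a)) v) \<longrightarrow>
      (\<forall>v\<in>set ts. less lt S (e' v) (e z)) \<longrightarrow> sat S e' \<phi>)" if "a \<in> univ S" for a
    using Cons.IH[of "e(t := a)"] Cons.prems asg_upd[OF Cons.prems(2) that, of t] by (simp del: fun_upd_apply add: fun_upd_other)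
  have "sat S e (Ball_below lt (t # ts) z \<phi>) \<longleftrightarrow>
     (\<forall>a\<in>univ S. less lt S a (e z) \<longrightarrow> sat S (e(t := a)) (Ball_below lt ts z \<phi>))"
    using Cons.prems by (auto simp: less_def)
  also have "\<dots> \<longleftrightarrow> (\<forall>e'. asg S e' \<longrightarrow> (\<forall>v. v \<notin> set (t # ts) \<longrightarrow> e' v = e v) \<longrightarrow>
      (\<forall>v\<in>set (t # ts). less lt S (e' v) (e z)) \<longrightarrow> sat S e' \<phi>)" (is "?L \<longleftrightarrow> ?R")
  proof
    assume L: ?L
    show ?R
    proof (intro allI impI)
      fix e' assume e': "asg S e'" "\<forall>v. v \<notin> set (t # ts) \<longrightarrow> e' v = e v"
        "\<forall>v\<in>set (t # ts). less lt S (e' v) (e z)"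
      have "e' t \<in> univ S" using e' by (simp add: asg_def)
      with L e'(3) have "sat S (e(t := e' t)) (Ball_below lt ts z \<phi>)" by simp
      with IH[OF \<open>e' t \<in> univ S\<close>] e' show "sat S e' \<phi>" by auto
    qed
  next
    assume R: ?R
    show ?L
    proof (intro ballI impI)
      fix a assume a: "a \<in> univ S" "less lt S a (e z)"
      show "sat S (e(t := a)) (Ball_below lt ts z \<phi>)"
        unfolding IH[OF a(1)]
      proof (intro allI impI)
        fix e' assume e': "asg S e'" "\<forall>v. v \<notin> set ts \<longrightarrow> e' v = (e(t := a)) v"
          "\<forall>v\<in>set ts. less lt S (e' v) (e z)"
        \<comment> \<open>The list may repeat \<open>t\<close>; then the inner quantifier fixes its
          value and supplies the bound, otherwise the value is \<open>a\<close>.\<close>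
        then have "less lt S (e' t) (e z)" using a by (cases "t \<in> set ts") auto
        then show "sat S e' \<phi>" using R e' by auto
      qed
    qed
  qed
  finally show ?case .
qed

lemma updl_apply: "updl e ts (map g ts) v = (if v \<in> set ts then g v else e v)"
  by (induction ts) auto

section \<open>Cardinalities of lists, terms and formulas\<close>

lemma infinite_times_self: "infinite A \<Longrightarrow> A \<times> A \<approx> A"
  by (simp add: eqpoll_iff_card_of_ordIso card_of_Times_same_infinite)

text \<open>Induction on the length with \<open>A \<times> A \<approx> A\<close> embeds the lists of
  each fixed length; recording the length beside these chosen injections treats all lengths at
  once.\<close>

lemma infinite_lists_lepoll:
  assumes "infinite A"
  shows "lists A \<lesssim> A"
proof -
  have "{xs \<in> lists A. length xs = n} \<lesssim> A" for n
  proof (induction n)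
    case 0
    have "{xs \<in> lists A. length xs = 0} = {[]}" by auto
    then show ?case using assms by (simp add: finite_lepoll_infinite)
  next
    case (Suc n)
    have "{xs \<in> lists A. length xs = Suc n} \<subseteq>
        (\<lambda>(a, xs). a # xs) ` (A \<times> {xs \<in> lists A. length xs = n})"
      by (auto simp: length_Suc_conv)
    then have "{xs \<in> lists A. length xs = Suc n} \<lesssim> A \<times> {xs \<in> lists A. length xs = n}"
      by (rule subset_image_lepoll)
    also have "\<dots> \<lesssim> A \<times> A" by (intro times_lepoll_mono Suc lepoll_refl)
    also have "\<dots> \<approx> A" by (rule infinite_times_self[OF assms])
    finally show ?case .
  qed
  then have "\<forall>n. \<exists>g. inj_on g {xs \<in> lists A. length xs = n} \<and> g ` {xs \<in> lists A. length xs = n} \<subseteq> A"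
    by (simp add: lepoll_def)
  from choice[OF this] obtain f where
    f: "\<forall>n. inj_on (f n) {xs \<in> lists A. length xs = n} \<and> f n ` {xs \<in> lists A. length xs = n} \<subseteq> A"
    by blast
  have "lists A \<lesssim> (UNIV :: nat set) \<times> A"
    unfolding lepoll_def
  proof (intro exI conjI)
    show "inj_on (\<lambda>xs. (length xs, f (length xs) xs)) (lists A)"
    proof (rule inj_onI)
      fix xs ys assume *: "xs \<in> lists A" "ys \<in> lists A"
        "(length xs, f (length xs) xs) = (length ys, f (length ys) ys)"
      have "inj_on (f (length ys)) {zs \<in> lists A. length zs = length ys}" using f by blast
      then show "xs = ys" by (rule inj_onD) (use * in auto)
    qed
    show "(\<lambda>xs. (length xs, f (length xs) xs)) ` lists A \<subseteq> UNIV \<times> A"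
    proof (rule image_subsetI)
      fix xs assume *: "xs \<in> lists A"
      have "f (length xs) ` {zs \<in> lists A. length zs = length xs} \<subseteq> A" using f by blast
      then have "f (length xs) xs \<in> A" by (rule subsetD) (rule imageI, use * in simp)
      then show "(length xs, f (length xs) xs) \<in> UNIV \<times> A" by simp
    qed
  qed
  also have "\<dots> \<lesssim> A \<times> A"
    using assms by (intro times_lepoll_mono) (auto simp: infinite_le_lepoll)
  also have "\<dots> \<approx> A" by (rule infinite_times_self[OF assms])
  finally show ?thesis .
qed

instance trm :: (countable) countable
  by countable_datatype

instance fm :: (countable, countable) countable
  by countable_datatype

text \<open>The symbols form a countable set, but their type need not be in class
  \<open>countable\<close>, so they are first renamed by natural numbers.\<close>

lemma countable_trms:
  assumes "countable (UNIV :: 'f set)"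
  shows "countable (UNIV :: 'f trm set)"
proof -
  obtain f :: "'f \<Rightarrow> nat" where "inj f" using assms by (auto simp: countable_def)
  then have "inj (map_trm f)" by (rule trm.inj_map)
  then show ?thesis by (rule countable_image_inj_on[rotated]) simp
qed

lemma countable_fms:
  assumes "countable (UNIV :: 'f set)" "countable (UNIV :: 'p set)"
  shows "countable (UNIV :: ('f, 'p) fm set)"
proof -
  obtain f :: "'f \<Rightarrow> nat" where "inj f" using assms by (auto simp: countable_def)
  moreover obtain g :: "'p \<Rightarrow> nat" where "inj g" using assms by (auto simp: countable_def)
  ultimately have "inj (map_fm f g)" by (rule fm.inj_map)
  then show ?thesis by (rule countable_image_inj_on[rotated]) simp
qed

section \<open>Stabilization under the inaccessibility scheme\<close>

text \<open>This is \<open>E\<^sub>\<phi>\<close> for the one-element tuple \<open>u\<close>, with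
  all other free variables of \<open>\<phi>\<close> as parameters; an assignment takes the place of
  the parameter tuple.\<close>

definition indisc ::
  "'p \<Rightarrow> ('a, 'f, 'p) struc \<Rightarrow> nat \<Rightarrow> ('f, 'p) fm \<Rightarrow> 'a \<Rightarrow> 'a \<Rightarrow> 'a \<Rightarrow> bool" where
  "indisc lt S u \<phi> z y y' \<longleftrightarrow>
    (\<forall>e. asg S e \<longrightarrow> (\<forall>v\<in>fv \<phi> - {u}. less lt S (e v) z) \<longrightarrow>
      (sat S (e(u := y)) \<phi> \<longleftrightarrow> sat S (e(u := y')) \<phi>))"

lemma indisc_sym: "indisc lt S u \<phi> z y y' \<Longrightarrow> indisc lt S u \<phi> z y' y"
  by (auto simp: indisc_def)

lemma indisc_trans:
  "indisc lt S u \<phi> z x y \<Longrightarrow> indisc lt S u \<phi> z y y' \<Longrightarrow> indisc lt S u \<phi> z x y'"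
  by (auto simp: indisc_def)

text \<open>What \<open>T\<close> yields for the single structure \<open>M\<close>: Skolem terms,
  and the scheme with one distinguished variable \<open>u\<close>. The bounds by \<open>a\<close>
  are strict, which rules out a maximum.\<close>

locale inaccessible_structure =
  fixes fa :: "'f \<Rightarrow> nat" and pa :: "'p \<Rightarrow> nat" and lt :: 'p
    and M :: "('a, 'f, 'p) struc" and a :: "nat \<Rightarrow> 'a"
  assumes countable_funs: "countable (UNIV :: 'f set)"
    and countable_rels: "countable (UNIV :: 'p set)"
    and lt_binary: "pa lt = 2"
    and struc: "is_struc fa M"
    and linear: "linear_order_in lt M"
    and skolem: "\<And>\<theta> y. wf_fm fa pa \<theta> \<Longrightarrow> \<exists>\<tau>. wf_trm fa \<tau> \<and>
      (\<forall>e. asg M e \<longrightarrow> (\<exists>b\<in>univ M. sat M (e(y := b)) \<theta>) \<longrightarrow> sat M (e(y := eval M e \<tau>)) \<theta>)"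
    and scheme: "\<And>\<phi> z u. wf_fm fa pa \<phi> \<Longrightarrow> z \<in> univ M \<Longrightarrow> \<exists>z1\<in>univ M. less lt M z z1 \<and>
      (\<forall>y\<in>univ M. \<exists>y1\<in>univ M. less lt M y1 z1 \<and> indisc lt M u \<phi> z y y1)"
    and a_in: "\<And>n. a n \<in> univ M"
    and a_Suc: "\<And>n. less lt M (a n) (a (Suc n))"
    and a_cofinal: "\<And>b. b \<in> univ M \<Longrightarrow> \<exists>n. less lt M b (a n)"
begin

abbreviation U :: "'a set" where "U \<equiv> univ M"

abbreviation lss :: "'a \<Rightarrow> 'a \<Rightarrow> bool" (infix "\<sqsubset>" 50) where "x \<sqsubset> y \<equiv> less lt M x y"

lemma lss_irrefl: "x \<in> U \<Longrightarrow> \<not> x \<sqsubset> x"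
  and lss_trans: "x \<sqsubset> y \<Longrightarrow> y \<sqsubset> z \<Longrightarrow> x \<in> U \<Longrightarrow> y \<in> U \<Longrightarrow> z \<in> U \<Longrightarrow> x \<sqsubset> z"
  and lss_total: "x \<in> U \<Longrightarrow> y \<in> U \<Longrightarrow> x \<sqsubset> y \<or> x = y \<or> y \<sqsubset> x"
  using linear unfolding linear_order_in_def by blast+

lemma lss_le_trans: "x \<sqsubset> y \<Longrightarrow> \<not> z \<sqsubset> y \<Longrightarrow> x \<in> U \<Longrightarrow> y \<in> U \<Longrightarrow> z \<in> U \<Longrightarrow> x \<sqsubset> z"
  using lss_total lss_trans by blast

lemma a_mono: "m < n \<Longrightarrow> a m \<sqsubset> a n"
proof (induction n)
  case (Suc n)
  then show ?case by (cases "m = n") (auto intro: a_Suc lss_trans[OF _ a_Suc] a_in)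
qed simp

lemma lss_a_mono: "x \<sqsubset> a m \<Longrightarrow> x \<in> U \<Longrightarrow> m \<le> n \<Longrightarrow> x \<sqsubset> a n"
  using a_mono[of m n] lss_trans[of x "a m" "a n"] a_in by (cases "m = n") auto

lemma finite_below_a:
  assumes "finite A" "A \<subseteq> U"
  shows "\<exists>n. \<forall>x\<in>A. x \<sqsubset> a n"
  using assms
proof (induction A)
  case (insert y A)
  then obtain m n where "\<forall>x\<in>A. x \<sqsubset> a m" "y \<sqsubset> a n" using a_cofinal by blast
  then have "\<forall>x\<in>insert y A. x \<sqsubset> a (max m n)"
    using insert.prems by (auto intro: lss_a_mono)
  then show ?case by blast
qed simp

lemma infinite_U: "infinite U"
proof
  assume "finite U"
  then obtain n where "\<forall>x\<in>U. x \<sqsubset> a n" using finite_below_a by blast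
  then show False using a_in lss_irrefl by blast
qed

text \<open>Let \<open>s\<close> be the bound that the scheme gives for \<open>\<psi>\<close> and
  \<open>z\<close>. Every \<open>b\<close> has an indiscernible twin \<open>y\<close> below
  \<open>s\<close>; \<open>\<psi>\<close> passes from \<open>s\<close> down to \<open>y\<close> by
  monotonicity and on to \<open>b\<close> because the other parameters are below
  \<open>z\<close>.\<close>

lemma stabilize:
  assumes wf: "wf_fm fa pa \<psi>" and z: "z \<in> U"
    and mono: "\<And>e b c. asg M e \<Longrightarrow> b \<in> U \<Longrightarrow> c \<in> U \<Longrightarrow> b \<sqsubset> c \<Longrightarrow>
      sat M (e(u := c)) \<psi> \<Longrightarrow> sat M (e(u := b)) \<psi>"
  shows "\<exists>s\<in>U. \<forall>e. asg M e \<longrightarrow> (\<forall>v\<in>fv \<psi> - {u}. e v \<sqsubset> z) \<longrightarrow>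
    sat M (e(u := s)) \<psi> \<longrightarrow> (\<forall>b\<in>U. sat M (e(u := b)) \<psi>)"
proof -
  obtain s where s: "s \<in> U" "\<And>y. y \<in> U \<Longrightarrow> \<exists>y1\<in>U. y1 \<sqsubset> s \<and> indisc lt M u \<psi> z y y1"
    using scheme[OF wf z, of u] by blast
  have "sat M (e(u := b)) \<psi>"
    if e: "asg M e" "\<forall>v\<in>fv \<psi> - {u}. e v \<sqsubset> z" "sat M (e(u := s)) \<psi>" and b: "b \<in> U" for e b
  proof -
    obtain y where y: "y \<in> U" "y \<sqsubset> s" "indisc lt M u \<psi> z b y" using s(2)[OF b] by blast
    have "sat M (e(u := y)) \<psi>" using mono[OF e(1) y(1) s(1) y(2)] e(3) by blast
    then show ?thesis using y(3) e unfolding indisc_def by blast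
  qed
  then show ?thesis using s(1) by blast
qed

text \<open>The formula saying that \<open>\<tau>\<close> is not below \<open>u\<close> is monotone
  as \<open>stabilize\<close> requires. If it held at the stable \<open>s\<close>, it would hold at
  every \<open>b\<close>, against the cofinality of \<open>a\<close>.\<close>

lemma collection:
  assumes "wf_trm fa \<tau>" and z: "z \<in> U"
  shows "\<exists>w\<in>U. \<forall>e. asg M e \<longrightarrow> (\<forall>v\<in>vars_trm \<tau>. e v \<sqsubset> z) \<longrightarrow> eval M e \<tau> \<sqsubset> w"
proof -
  obtain u where u: "u \<notin> vars_trm \<tau>" using ex_new_if_finite finite_vars_trm infinite_UNIV_nat by blast
  define \<psi> :: "('f, 'p) fm" where "\<psi> = Neg (Rel lt [\<tau>, Var u])"
  have ev: "eval M (e(u := b)) \<tau> = eval M e \<tau>" for e b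
    by (rule eval_cong) (use u in auto)
  have sat: "sat M (e(u := b)) \<psi> \<longleftrightarrow> \<not> eval M e \<tau> \<sqsubset> b" for e b
    unfolding \<psi>_def by (simp add: ev less_def)
  have in_U: "eval M e \<tau> \<in> U" if "asg M e" for e
    using eval_in_univ[OF struc assms(1)] that by (simp add: asg_def)
  have "\<exists>s\<in>U. \<forall>e. asg M e \<longrightarrow> (\<forall>v\<in>fv \<psi> - {u}. e v \<sqsubset> z) \<longrightarrow>
    sat M (e(u := s)) \<psi> \<longrightarrow> (\<forall>b\<in>U. sat M (e(u := b)) \<psi>)"
  proof (rule stabilize[OF _ z])
    show "wf_fm fa pa \<psi>" using assms lt_binary by (simp add: \<psi>_def)
    show "sat M (e(u := b)) \<psi>" if "asg M e" "b \<in> U" "c \<in> U" "b \<sqsubset> c" "sat M (e(u := c)) \<psi>" for e b c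
      using that lss_trans[of "eval M e \<tau>" b c] in_U unfolding sat by blast
  qed
  then obtain s where s: "s \<in> U" "\<And>e b. asg M e \<Longrightarrow> \<forall>v\<in>fv \<psi> - {u}. e v \<sqsubset> z \<Longrightarrow>
    \<not> eval M e \<tau> \<sqsubset> s \<Longrightarrow> b \<in> U \<Longrightarrow> \<not> eval M e \<tau> \<sqsubset> b"
    unfolding sat by blast
  have "eval M e \<tau> \<sqsubset> s" if "asg M e" "\<forall>v\<in>vars_trm \<tau>. e v \<sqsubset> z" for e
  proof (rule ccontr)
    assume "\<not> eval M e \<tau> \<sqsubset> s"
    moreover have "\<forall>v\<in>fv \<psi> - {u}. e v \<sqsubset> z" using that by (auto simp: \<psi>_def)
    ultimately show False using s(2)[OF that(1)] a_cofinal[OF in_U[OF that(1)]] a_in by blast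
  qed
  then show ?thesis using s(1) by blast
qed

text \<open>Call \<open>y\<close> and \<open>t\<close> equivalent if \<open>\<phi>\<close> with parameters below \<open>z\<close> does not distinguish them. The
  set of \<open>t\<close> below a bound \<open>z1\<close> that are equivalent to some \<open>y \<ge> u\<close> decreases in \<open>u\<close>, hence
  stabilizes; the scheme provides \<open>z1\<close> such that every element has an equivalent below it.\<close>
lemma unbounded_class:
  assumes wf: "wf_fm fa pa \<phi>" and z: "z \<in> U"
  shows "\<exists>s\<in>U. \<forall>y\<in>U. \<not> y \<sqsubset> s \<longrightarrow> (\<forall>b\<in>U. \<exists>y'\<in>U. \<not> y' \<sqsubset> b \<and> indisc lt M 0 \<phi> z y' y)"
proof -
  obtain K where K: "0 < K" "\<And>v. v \<in> fv \<phi> \<Longrightarrow> v < K"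
    using finite_nat_set_iff_bounded[of "insert 0 (fv \<phi>)"] finite_fv[of \<phi>] by auto
  obtain ts where ts: "set ts = fv \<phi> - {0}" using finite_list finite_fv by (metis finite_Diff)
  \<comment> \<open>Like \<open>K\<close>, these variables are fresh for \<open>\<phi>\<close>:
    \<open>K\<close> holds the bound on the parameters, \<open>p\<close> the witness,
    \<open>t\<close> the point compared with it and \<open>u\<close> the moving threshold.\<close>
  define p t u where "p = Suc K" "t = Suc (Suc K)" "u = Suc (Suc (Suc K))"
  define eqv where "eqv = Ball_below lt ts K (Iff (Inst 0 p \<phi>) (Inst 0 t \<phi>))"
  define \<psi> :: "('f, 'p) fm" where "\<psi> = Ex p (Conj (Neg (Rel lt [Var p, Var u])) eqv)"
  have sat_eqv: "sat M e eqv \<longleftrightarrow> indisc lt M 0 \<phi> (e K) (e p) (e t)" if e: "asg M e" for e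
  proof -
    have inst: "sat M e' (Iff (Inst 0 p \<phi>) (Inst 0 t \<phi>)) \<longleftrightarrow>
        (sat M (e'(0 := e p)) \<phi> \<longleftrightarrow> sat M (e'(0 := e t)) \<phi>)"
      if "asg M e'" "\<forall>v. v \<notin> set ts \<longrightarrow> e' v = e v" for e'
    proof -
      have "p \<notin> set ts" "t \<notin> set ts" using K(2)[of p] K(2)[of t] unfolding ts p_t_u_def by auto
      then have "e' p = e p" "e' t = e t" using that by auto
      moreover have "p \<noteq> 0" "t \<noteq> 0" by (simp_all add: p_t_u_def)
      moreover have "e p \<in> U" "e t \<in> U" using e by (simp_all add: asg_def)
      ultimately show ?thesis by (simp add: sat_Inst)
    qed
    have "K \<notin> set ts" using K(2)[of K] unfolding ts by auto
    then have *: "sat M e eqv \<longleftrightarrow> (\<forall>e'. asg M e' \<longrightarrow> (\<forall>v. v \<notin> set ts \<longrightarrow> e' v = e v) \<longrightarrow>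
      (\<forall>v\<in>set ts. e' v \<sqsubset> e K) \<longrightarrow> (sat M (e'(0 := e p)) \<phi> \<longleftrightarrow> sat M (e'(0 := e t)) \<phi>))"
      unfolding eqv_def sat_Ball_below[OF \<open>K \<notin> set ts\<close> e] using inst by blast
    show ?thesis unfolding *
    proof (intro iffI)
      assume L: "\<forall>e'. asg M e' \<longrightarrow> (\<forall>v. v \<notin> set ts \<longrightarrow> e' v = e v) \<longrightarrow>
        (\<forall>v\<in>set ts. e' v \<sqsubset> e K) \<longrightarrow> (sat M (e'(0 := e p)) \<phi> \<longleftrightarrow> sat M (e'(0 := e t)) \<phi>)"
      show "indisc lt M 0 \<phi> (e K) (e p) (e t)" unfolding indisc_def
      proof (intro allI impI)
        fix e0 assume e0: "asg M e0" "\<forall>v\<in>fv \<phi> - {0}. e0 v \<sqsubset> e K"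
        define e' where "e' v = (if v \<in> set ts then e0 v else e v)" for v
        have "asg M e'" using e e0 by (simp add: e'_def asg_def)
        then have "sat M (e'(0 := e p)) \<phi> \<longleftrightarrow> sat M (e'(0 := e t)) \<phi>"
          using L e0 by (auto simp: e'_def ts)
        moreover have "sat M (e'(0 := x)) \<phi> \<longleftrightarrow> sat M (e0(0 := x)) \<phi>" for x
          by (rule sat_cong) (auto simp: e'_def ts)
        ultimately show "sat M (e0(0 := e p)) \<phi> \<longleftrightarrow> sat M (e0(0 := e t)) \<phi>" by simp
      qed
    next
      assume "indisc lt M 0 \<phi> (e K) (e p) (e t)"
      then show "\<forall>e'. asg M e' \<longrightarrow> (\<forall>v. v \<notin> set ts \<longrightarrow> e' v = e v) \<longrightarrow>
        (\<forall>v\<in>set ts. e' v \<sqsubset> e K) \<longrightarrow> (sat M (e'(0 := e p)) \<phi> \<longleftrightarrow> sat M (e'(0 := e t)) \<phi>)"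
        unfolding indisc_def ts by blast
    qed
  qed
  have sat_\<psi>: "sat M e \<psi> \<longleftrightarrow> (\<exists>y\<in>U. \<not> y \<sqsubset> e u \<and> indisc lt M 0 \<phi> (e K) y (e t))" if e: "asg M e" for e
  proof -
    have "sat M e \<psi> \<longleftrightarrow> (\<exists>y\<in>U. \<not> y \<sqsubset> e u \<and> sat M (e(p := y)) eqv)"
      by (simp add: \<psi>_def less_def p_t_u_def)
    also have "\<dots> \<longleftrightarrow> (\<exists>y\<in>U. \<not> y \<sqsubset> e u \<and> indisc lt M 0 \<phi> (e K) y (e t))"
      using sat_eqv[OF asg_upd[OF e]] by (auto simp: p_t_u_def)
    finally show ?thesis .
  qed
  have "wf_fm fa pa \<psi>"
    unfolding \<psi>_def eqv_def using wf lt_binary by (simp add: wf_Ball_below)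
  have "fv eqv \<subseteq> insert K (fv (Iff (Inst 0 p \<phi>) (Inst 0 t \<phi>)) - set ts)"
    unfolding eqv_def by (rule fv_Ball_below)
  also have "\<dots> \<subseteq> {K, p, t}" unfolding ts using fv_Inst[of 0 p \<phi>] fv_Inst[of 0 t \<phi>] by auto
  finally have fv: "fv \<psi> \<subseteq> {u, K, t}" by (auto simp: \<psi>_def)
  obtain z1 where z1: "z1 \<in> U" "z \<sqsubset> z1"
    "\<And>y. y \<in> U \<Longrightarrow> \<exists>y1\<in>U. y1 \<sqsubset> z1 \<and> indisc lt M 0 \<phi> z y y1"
    using scheme[OF wf z, of 0] by blast
  have "\<exists>s\<in>U. \<forall>e. asg M e \<longrightarrow> (\<forall>v\<in>fv \<psi> - {u}. e v \<sqsubset> z1) \<longrightarrow>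
    sat M (e(u := s)) \<psi> \<longrightarrow> (\<forall>b\<in>U. sat M (e(u := b)) \<psi>)"
  proof (rule stabilize[OF \<open>wf_fm fa pa \<psi>\<close> z1(1)])
    fix e b c assume *: "asg M e" "b \<in> U" "c \<in> U" "b \<sqsubset> c" "sat M (e(u := c)) \<psi>"
    have "u \<noteq> K" "u \<noteq> t" by (auto simp: p_t_u_def)
    then show "sat M (e(u := b)) \<psi>"
      using * lss_trans[of _ b c] by (auto simp: sat_\<psi> asg_upd)
  qed
  then obtain s where s: "s \<in> U" "\<And>e b. asg M e \<Longrightarrow> \<forall>v\<in>fv \<psi> - {u}. e v \<sqsubset> z1 \<Longrightarrow>
    sat M (e(u := s)) \<psi> \<Longrightarrow> b \<in> U \<Longrightarrow> sat M (e(u := b)) \<psi>" by blast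
  have "\<exists>y'\<in>U. \<not> y' \<sqsubset> b \<and> indisc lt M 0 \<phi> z y' y" if y: "y \<in> U" "\<not> y \<sqsubset> s" and b: "b \<in> U" for y b
  proof -
    \<comment> \<open>\<open>y\<close> may lie above \<open>z1\<close>, so stabilization is applied
      to its twin \<open>y1\<close>; \<open>y\<close> itself is the witness at threshold
      \<open>s\<close>. The default value \<open>z\<close> of the assignment is the one meant for
      \<open>K\<close>.\<close>
    obtain y1 where y1: "y1 \<in> U" "y1 \<sqsubset> z1" "indisc lt M 0 \<phi> z y y1" using z1(3)[OF y(1)] by blast
    define e where "e = (\<lambda>_. z)(t := y1)"
    have e: "asg M e" using z y1 by (simp add: e_def asg_def)
    have sat_e: "sat M (e(u := x)) \<psi> \<longleftrightarrow> (\<exists>y\<in>U. \<not> y \<sqsubset> x \<and> indisc lt M 0 \<phi> z y y1)" if "x \<in> U" for x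
      using sat_\<psi>[OF asg_upd[OF e that]] by (simp add: e_def p_t_u_def)
    have "sat M (e(u := b)) \<psi>"
    proof (rule s(2)[OF e _ _ b])
      show "\<forall>v\<in>fv \<psi> - {u}. e v \<sqsubset> z1" using fv y1 z1 by (auto simp: e_def)
      show "sat M (e(u := s)) \<psi>" unfolding sat_e[OF s(1)] using y y1 by blast
    qed
    then show ?thesis unfolding sat_e[OF b] using indisc_trans[OF _ indisc_sym[OF y1(3)]] by blast
  qed
  then show ?thesis using s(1) by blast
qed

text \<open>The truth value of \<open>p = q\<close> for two fresh parameters selects one of the two formulas.\<close>
lemma combine:
  assumes wf: "wf_fm fa pa \<phi>" "wf_fm fa pa \<psi>"
  shows "\<exists>\<chi>. wf_fm fa pa \<chi> \<and> (\<forall>z c c' y y'. c \<in> U \<longrightarrow> c' \<in> U \<longrightarrow> c \<noteq> c' \<longrightarrow> c \<sqsubset> z \<longrightarrow> c' \<sqsubset> z \<longrightarrow>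
    indisc lt M 0 \<chi> z y y' \<longrightarrow> indisc lt M 0 \<phi> z y y' \<and> indisc lt M 0 \<psi> z y y')"
proof -
  obtain K where K: "0 < K" "\<And>v. v \<in> fv \<phi> \<union> fv \<psi> \<Longrightarrow> v < K"
    using finite_nat_set_iff_bounded[of "insert 0 (fv \<phi> \<union> fv \<psi>)"] finite_fv by auto
  define same :: "('f, 'p) fm" where "same = Eq (Var K) (Var (Suc K))"
  define \<chi> where "\<chi> = Or (Conj same \<phi>) (Conj (Neg same) \<psi>)"
  have fresh: "K \<notin> fv \<phi>" "Suc K \<notin> fv \<phi>" "K \<notin> fv \<psi>" "Suc K \<notin> fv \<psi>"
    using K(2)[of K] K(2)[of "Suc K"] by auto
  have "wf_fm fa pa \<chi>" using wf by (simp add: \<chi>_def same_def)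
  moreover have "indisc lt M 0 \<phi> z y y' \<and> indisc lt M 0 \<psi> z y y'"
    if c: "c \<in> U" "c' \<in> U" "c \<noteq> c'" "c \<sqsubset> z" "c' \<sqsubset> z" and \<chi>: "indisc lt M 0 \<chi> z y y'" for z c c' y y'
  proof
    show "indisc lt M 0 \<phi> z y y'" unfolding indisc_def
    proof (intro allI impI)
      fix e assume e: "asg M e" "\<forall>v\<in>fv \<phi> - {0}. e v \<sqsubset> z"
      \<comment> \<open>Both selectors \<open>K\<close> and \<open>Suc K\<close> get the value
        \<open>c\<close>, so \<open>same\<close> is true and \<open>\<chi>\<close> reduces to
        \<open>\<phi>\<close>.\<close>
      define e' where "e' v = (if v \<in> fv \<phi> then e v else c)" for v
      have "asg M e'" "\<forall>v\<in>fv \<chi> - {0}. e' v \<sqsubset> z" using e c by (auto simp: e'_def asg_def)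
      then have "sat M (e'(0 := y)) \<chi> \<longleftrightarrow> sat M (e'(0 := y')) \<chi>" using \<chi> unfolding indisc_def by blast
      moreover have "sat M (e'(0 := x)) \<chi> \<longleftrightarrow> sat M (e'(0 := x)) \<phi>" for x
        using fresh K(1) by (simp add: \<chi>_def same_def e'_def)
      moreover have "sat M (e'(0 := x)) \<phi> \<longleftrightarrow> sat M (e(0 := x)) \<phi>" for x
        by (rule sat_cong) (auto simp: e'_def)
      ultimately show "sat M (e(0 := y)) \<phi> \<longleftrightarrow> sat M (e(0 := y')) \<phi>" by simp
    qed
    show "indisc lt M 0 \<psi> z y y'" unfolding indisc_def
    proof (intro allI impI)
      fix e assume e: "asg M e" "\<forall>v\<in>fv \<psi> - {0}. e v \<sqsubset> z"
      \<comment> \<open>Here \<open>K\<close> gets \<open>c'\<close> and \<open>Suc K\<close> gets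
        \<open>c\<close>, so \<open>same\<close> is false and \<open>\<chi>\<close> reduces to
        \<open>\<psi>\<close>.\<close>
      define e' where "e' v = (if v \<in> fv \<psi> then e v else if v = K then c' else c)" for v
      have "asg M e'" "\<forall>v\<in>fv \<chi> - {0}. e' v \<sqsubset> z" using e c by (auto simp: e'_def asg_def)
      then have "sat M (e'(0 := y)) \<chi> \<longleftrightarrow> sat M (e'(0 := y')) \<chi>" using \<chi> unfolding indisc_def by blast
      moreover have "sat M (e'(0 := x)) \<chi> \<longleftrightarrow> sat M (e'(0 := x)) \<psi>" for x
        using fresh K(1) c(3) by (simp add: \<chi>_def same_def e'_def)
      moreover have "sat M (e'(0 := x)) \<psi> \<longleftrightarrow> sat M (e(0 := x)) \<psi>" for x
        by (rule sat_cong) (auto simp: e'_def)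
      ultimately show "sat M (e(0 := y)) \<psi> \<longleftrightarrow> sat M (e(0 := y')) \<psi>" by simp
    qed
  qed
  ultimately show ?thesis by blast
qed

text \<open>Iterates \<open>combine\<close>; one pair \<open>c\<close>, \<open>c'\<close> serves all
  stages.\<close>

lemma combine_upto:
  fixes n :: nat
  assumes "\<And>i. wf_fm fa pa (\<Phi> i)"
  shows "\<exists>\<chi>. wf_fm fa pa \<chi> \<and> (\<forall>z c c' y y'. c \<in> U \<longrightarrow> c' \<in> U \<longrightarrow> c \<noteq> c' \<longrightarrow> c \<sqsubset> z \<longrightarrow> c' \<sqsubset> z \<longrightarrow>
    indisc lt M 0 \<chi> z y y' \<longrightarrow> (\<forall>i\<le>n. indisc lt M 0 (\<Phi> i) z y y'))"
proof (induction n)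
  case 0
  then show ?case using assms[of 0] by auto
next
  case (Suc n)
  then obtain \<psi> where \<psi>: "wf_fm fa pa \<psi>"
    "\<And>z c c' y y'. c \<in> U \<Longrightarrow> c' \<in> U \<Longrightarrow> c \<noteq> c' \<Longrightarrow> c \<sqsubset> z \<Longrightarrow> c' \<sqsubset> z \<Longrightarrow>
      indisc lt M 0 \<psi> z y y' \<Longrightarrow> (\<forall>i\<le>n. indisc lt M 0 (\<Phi> i) z y y')" by blast
  obtain \<chi> where \<chi>: "wf_fm fa pa \<chi>"
    "\<And>z c c' y y'. c \<in> U \<Longrightarrow> c' \<in> U \<Longrightarrow> c \<noteq> c' \<Longrightarrow> c \<sqsubset> z \<Longrightarrow> c' \<sqsubset> z \<Longrightarrow>
      indisc lt M 0 \<chi> z y y' \<Longrightarrow> indisc lt M 0 \<psi> z y y' \<and> indisc lt M 0 (\<Phi> (Suc n)) z y y'"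
    using combine[OF \<psi>(1) assms[of "Suc n"]] by blast
  have "\<forall>i\<le>Suc n. indisc lt M 0 (\<Phi> i) z y y'"
    if "c \<in> U" "c' \<in> U" "c \<noteq> c'" "c \<sqsubset> z" "c' \<sqsubset> z" "indisc lt M 0 \<chi> z y y'" for z c c' y y'
    using \<chi>(2)[OF that] \<psi>(2)[OF that(1-5), of y y'] by (simp add: le_Suc_eq)
  then show ?case using \<chi>(1) by blast
qed

section \<open>The descending sequence of indiscernible sets\<close>

lemma indisc_mono:
  assumes "indisc lt M 0 \<phi> (a n) y y'" "m \<le> n"
  shows "indisc lt M 0 \<phi> (a m) y y'"
  unfolding indisc_def
proof (intro allI impI)
  fix e assume e: "asg M e" "\<forall>v\<in>fv \<phi> - {0}. e v \<sqsubset> a m"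
  then have "\<forall>v\<in>fv \<phi> - {0}. e v \<sqsubset> a n" using lss_a_mono[OF _ _ assms(2)] unfolding asg_def by blast
  then show "sat M (e(0 := y)) \<phi> \<longleftrightarrow> sat M (e(0 := y')) \<phi>"
    using assms(1) e(1) unfolding indisc_def by blast
qed

text \<open>With the formulas enumerated as \<open>\<Phi>\<close>, \<open>C n\<close> is an
  unbounded class of \<open>E n\<close>, which takes care of all formulas up to index
  \<open>n\<close>; the formula \<open>\<Phi> k\<close> is therefore settled on \<open>C n\<close>
  from \<open>n = k\<close> on.\<close>

lemma indiscernible_filter:
  "\<exists>C. (\<forall>n. C n \<subseteq> U) \<and> (\<forall>n. C (Suc n) \<subseteq> C n) \<and> (\<forall>n. \<forall>b\<in>U. \<exists>y\<in>C n. b \<sqsubset> y) \<and>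
    (\<forall>\<phi>. wf_fm fa pa \<phi> \<longrightarrow> (\<exists>k. \<forall>n\<ge>k. \<forall>x\<in>C n. \<forall>y\<in>C n. indisc lt M 0 \<phi> (a n) x y))"
proof -
  define W where "W = {\<phi> :: ('f, 'p) fm. wf_fm fa pa \<phi>}"
  have "wf_fm fa pa (Eq (Var 0) (Var 0))" by simp
  then have W: "W \<noteq> {}" "countable W"
    using countable_fms[OF countable_funs countable_rels] unfolding W_def
    by (blast, meson countable_subset subset_UNIV)
  define \<Phi> where "\<Phi> = from_nat_into W"
  have wf_\<Phi>: "wf_fm fa pa (\<Phi> i)" for i
    using from_nat_into[OF W(1), of i] by (simp add: \<Phi>_def W_def)
  \<comment> \<open>The shift by 2 leaves two elements below the bound, as \<open>combine_upto\<close> requires.\<close>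
  define E where "E n x y \<longleftrightarrow> (\<forall>i\<le>n. indisc lt M 0 (\<Phi> i) (a (n + 2)) x y)" for n x y
  have E_trans: "E n x z" if "E n x y" "E n y z" for n x y z
    using that indisc_trans[of lt M 0 _ _ x y z] unfolding E_def by blast
  have E_sym: "E n y x" if "E n x y" for n x y
    using that indisc_sym[of lt M 0 _ _ x y] unfolding E_def by blast
  have E_Suc: "E n x y" if "E (Suc n) x y" for n x y
    using that indisc_mono[of _ "Suc n + 2" x y "n + 2"] unfolding E_def by auto
  have large: "\<exists>s\<in>U. \<forall>y\<in>U. \<not> y \<sqsubset> s \<longrightarrow> (\<forall>b\<in>U. \<exists>y'\<in>U. \<not> y' \<sqsubset> b \<and> E n y' y)" for n
  proof -
    obtain \<chi> where \<chi>: "wf_fm fa pa \<chi>"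
      "\<And>z c c' y y'. c \<in> U \<Longrightarrow> c' \<in> U \<Longrightarrow> c \<noteq> c' \<Longrightarrow> c \<sqsubset> z \<Longrightarrow> c' \<sqsubset> z \<Longrightarrow>
        indisc lt M 0 \<chi> z y y' \<Longrightarrow> (\<forall>i\<le>n. indisc lt M 0 (\<Phi> i) z y y')"
      using combine_upto[of \<Phi> n, OF wf_\<Phi>] by blast
    have "a n \<noteq> a (Suc n)" using a_Suc[of n] lss_irrefl[OF a_in[of n]] by auto
    then have "E n y' y" if "indisc lt M 0 \<chi> (a (n + 2)) y' y" for y y'
      using \<chi>(2)[of "a n" "a (Suc n)" "a (n + 2)" y' y] that unfolding E_def
      by (simp add: a_in a_mono)
    then show ?thesis using unbounded_class[OF \<chi>(1) a_in[of "n + 2"]] by blast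
  qed
  define P where "P n r \<longleftrightarrow> r \<in> U \<and> (\<forall>b\<in>U. \<exists>y\<in>U. \<not> y \<sqsubset> b \<and> E n y r)" for n r
  have "\<exists>r. \<forall>n. P n (r n) \<and> E n (r (Suc n)) (r n)"
  proof (rule dependent_nat_choice)
    obtain s where "s \<in> U" "\<forall>y\<in>U. \<not> y \<sqsubset> s \<longrightarrow> (\<forall>b\<in>U. \<exists>y'\<in>U. \<not> y' \<sqsubset> b \<and> E 0 y' y)"
      using large by blast
    \<comment> \<open>\<open>s\<close> itself qualifies, since it is not below itself.\<close>
    then show "\<exists>r. P 0 r" unfolding P_def using lss_irrefl by blast
  next
    fix r n assume r: "P n r"
    obtain s where s: "s \<in> U" "\<forall>y\<in>U. \<not> y \<sqsubset> s \<longrightarrow> (\<forall>b\<in>U. \<exists>y'\<in>U. \<not> y' \<sqsubset> b \<and> E (Suc n) y' y)"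
      using large by blast
    \<comment> \<open>The unbounded class of \<open>r\<close> reaches past \<open>s\<close>, and
      every element there has an unbounded class for the finer relation
      \<open>E (Suc n)\<close>.\<close>
    obtain y where "y \<in> U" "\<not> y \<sqsubset> s" "E n y r" using r s(1) unfolding P_def by blast
    then show "\<exists>r'. P (Suc n) r' \<and> E n r' r" using s(2) unfolding P_def by blast
  qed
  then obtain r where r: "\<And>n. P n (r n)" "\<And>n. E n (r (Suc n)) (r n)" by blast
  define C where "C n = {y \<in> U. E n y (r n)}" for n
  have "C (Suc n) \<subseteq> C n" for n
    unfolding C_def using E_Suc E_trans r(2) by blast
  moreover have "\<exists>y\<in>C n. b \<sqsubset> y" if b: "b \<in> U" for n b
  proof -
    obtain m where "b \<sqsubset> a m" using a_cofinal[OF b] by blast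
    moreover obtain y where "y \<in> U" "\<not> y \<sqsubset> a m" "E n y (r n)"
      using r(1)[of n] a_in unfolding P_def by blast
    ultimately show ?thesis using lss_le_trans[OF _ _ b a_in] unfolding C_def by blast
  qed
  moreover have "\<exists>k. \<forall>n\<ge>k. \<forall>x\<in>C n. \<forall>y\<in>C n. indisc lt M 0 \<phi> (a n) x y" if "wf_fm fa pa \<phi>" for \<phi>
  proof -
    obtain k where k: "\<phi> = \<Phi> k"
      using from_nat_into_surj[OF W(2), of \<phi>] \<open>wf_fm fa pa \<phi>\<close> unfolding \<Phi>_def W_def by auto
    have "indisc lt M 0 \<phi> (a n) x y" if "k \<le> n" "x \<in> C n" "y \<in> C n" for n x y
    proof -
      have "E n x y" using that E_trans E_sym unfolding C_def by blast
      then have "indisc lt M 0 \<phi> (a (n + 2)) x y" using that(1) k unfolding E_def by blast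
      then show ?thesis by (rule indisc_mono) simp
    qed
    then show ?thesis by blast
  qed
  ultimately show ?thesis by (intro exI[of _ C]) (auto simp: C_def)
qed

end

section \<open>The definable ultrapower\<close>

locale indiscernible_ultrapower = inaccessible_structure fa pa lt M a
  for fa :: "'f \<Rightarrow> nat" and pa :: "'p \<Rightarrow> nat" and lt :: 'p
    and M :: "('a, 'f, 'p) struc" and a :: "nat \<Rightarrow> 'a" +
  fixes C :: "nat \<Rightarrow> 'a set"
  assumes C_sub: "\<And>n. C n \<subseteq> U"
    and C_Suc: "\<And>n. C (Suc n) \<subseteq> C n"
    and C_unbounded: "\<And>n b. b \<in> U \<Longrightarrow> \<exists>y\<in>C n. b \<sqsubset> y"
    and C_indisc: "\<And>\<phi>. wf_fm fa pa \<phi> \<Longrightarrow>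
      \<exists>k. \<forall>n\<ge>k. \<forall>x\<in>C n. \<forall>y\<in>C n. indisc lt M 0 \<phi> (a n) x y"
begin

section \<open>The filter generated by the sets \<open>C n\<close>\<close>

definition ev :: "('a \<Rightarrow> bool) \<Rightarrow> bool" where
  "ev P \<longleftrightarrow> (\<exists>n. \<forall>x\<in>C n. P x)"

lemma C_antimono: "m \<le> n \<Longrightarrow> C n \<subseteq> C m"
  by (rule lift_Suc_antimono_le[of C]) (use C_Suc in auto)

lemma ev_mono: "ev P \<Longrightarrow> (\<And>x. x \<in> U \<Longrightarrow> P x \<Longrightarrow> Q x) \<Longrightarrow> ev Q"
  unfolding ev_def using C_sub by blast

lemma ev_all: "(\<And>x. x \<in> U \<Longrightarrow> P x) \<Longrightarrow> ev P"
  unfolding ev_def using C_sub by blast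

lemma ev_conj: "ev P \<Longrightarrow> ev Q \<Longrightarrow> ev (\<lambda>x. P x \<and> Q x)"
  unfolding ev_def
proof (elim exE)
  fix m n assume "\<forall>x\<in>C m. P x" "\<forall>x\<in>C n. Q x"
  then have "\<forall>x\<in>C (max m n). P x \<and> Q x"
    using C_antimono[of m "max m n"] C_antimono[of n "max m n"] by auto
  then show "\<exists>n. \<forall>x\<in>C n. P x \<and> Q x" by blast
qed

lemma ev_ball_finite: "finite A \<Longrightarrow> (\<And>t. t \<in> A \<Longrightarrow> ev (P t)) \<Longrightarrow> ev (\<lambda>x. \<forall>t\<in>A. P t x)"
proof (induction A rule: finite_induct)
  case empty
  then show ?case by (simp add: ev_all)
next
  case (insert t A)
  then have "ev (\<lambda>x. P t x \<and> (\<forall>t\<in>A. P t x))" by (simp add: ev_conj)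
  then show ?case by simp
qed

lemma ev_cong: "ev (\<lambda>x. P x \<longleftrightarrow> Q x) \<Longrightarrow> ev P \<longleftrightarrow> ev Q"
  using ev_conj[of "\<lambda>x. P x \<longleftrightarrow> Q x" P] ev_conj[of "\<lambda>x. P x \<longleftrightarrow> Q x" Q]
  by (auto elim: ev_mono)

text \<open>Properness of the filter: unboundedness makes every \<open>C n\<close> nonempty.\<close>

lemma ev_const [simp]: "ev (\<lambda>x. P) \<longleftrightarrow> P"
  unfolding ev_def using C_unbounded[OF a_in] by blast

lemma ev_not: "ev (\<lambda>x. \<not> P x) \<Longrightarrow> \<not> ev P"
  using ev_conj[of P "\<lambda>x. \<not> P x"] ev_const[of False] by auto

text \<open>The filter is nonprincipal; this later keeps the class of the identity out of the image
  of \<open>M\<close>.\<close>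

lemma ev_above: "b \<in> U \<Longrightarrow> \<not> ev (\<lambda>x. x = b)"
  unfolding ev_def by (metis C_unbounded lss_irrefl)

text \<open>Variable \<open>0\<close> is the argument and \<open>e\<close> carries the parameters
  from \<open>M\<close>. Thanks to Skolem functions, terms are enough to capture the definable
  functions.\<close>

definition F :: "('a \<Rightarrow> 'a) set" where
  "F = {\<lambda>x. eval M (e(0 := x)) \<tau> | e \<tau>. asg M e \<and> wf_trm fa \<tau>}"

lemma F_in_U: "g \<in> F \<Longrightarrow> x \<in> U \<Longrightarrow> g x \<in> U"
  unfolding F_def by (auto intro!: eval_in_univ[OF struc] simp: asg_def)

lemma F_id: "(\<lambda>x. x) \<in> F"
  unfolding F_def using a_in[of 0] by (auto intro!: exI[of _ "\<lambda>_. a 0"] exI[of _ "Var 0"] simp: asg_def)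

lemma F_const: "b \<in> U \<Longrightarrow> (\<lambda>_. b) \<in> F"
  unfolding F_def by (auto intro!: exI[of _ "\<lambda>_. b"] exI[of _ "Var (Suc 0)"] simp: asg_def)

text \<open>The parameters of the \<open>g v\<close> are made disjoint by the pairing function.\<close>
lemma F_eval:
  assumes wf: "wf_trm fa \<tau>" and g: "\<And>v. g v \<in> F"
  shows "(\<lambda>x. eval M (\<lambda>v. g v x) \<tau>) \<in> F"
proof -
  have "\<forall>v. \<exists>e \<sigma>. g v = (\<lambda>x. eval M (e(0 := x)) \<sigma>) \<and> asg M e \<and> wf_trm fa \<sigma>"
    using g unfolding F_def by blast
  then obtain E where "\<forall>v. \<exists>\<sigma>. g v = (\<lambda>x. eval M ((E v)(0 := x)) \<sigma>) \<and> asg M (E v) \<and> wf_trm fa \<sigma>"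
    using choice[of "\<lambda>v e. \<exists>\<sigma>. g v = (\<lambda>x. eval M (e(0 := x)) \<sigma>) \<and> asg M e \<and> wf_trm fa \<sigma>"] by blast
  then obtain R where R: "\<forall>v. g v = (\<lambda>x. eval M ((E v)(0 := x)) (R v)) \<and> asg M (E v) \<and> wf_trm fa (R v)"
    using choice[of "\<lambda>v \<sigma>. g v = (\<lambda>x. eval M ((E v)(0 := x)) \<sigma>) \<and> asg M (E v) \<and> wf_trm fa \<sigma>"] by blast
  define \<rho> :: "nat \<Rightarrow> nat \<Rightarrow> 'f trm"
    where "\<rho> v w = (if w = 0 then Var 0 else Var (Suc (prod_encode (v, w))))" for v w
  \<comment> \<open>\<open>0\<close> is the argument of the functions, so the value
    \<open>a 0\<close> there is always overwritten.\<close>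
  define e where "e k = (case k of 0 \<Rightarrow> a 0 | Suc j \<Rightarrow> E (fst (prod_decode j)) (snd (prod_decode j)))" for k
  define \<sigma> where "\<sigma> = subst_trm (\<lambda>v. subst_trm (\<rho> v) (R v)) \<tau>"
  have "asg M e" unfolding e_def asg_def using R a_in by (auto split: nat.split simp: asg_def)
  moreover have "wf_trm fa \<sigma>"
    unfolding \<sigma>_def using R wf by (intro wf_subst_trm) (auto simp: \<rho>_def)
  moreover have "eval M (e(0 := x)) \<sigma> = eval M (\<lambda>v. g v x) \<tau>" for x
  proof -
    have "(\<lambda>w. eval M (e(0 := x)) (\<rho> v w)) = (E v)(0 := x)" for v
      by (auto simp: \<rho>_def e_def)
    then have "eval M (e(0 := x)) (subst_trm (\<rho> v) (R v)) = g v x" for v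
      using R[THEN spec, of v, THEN conjunct1] by (simp add: eval_subst_trm)
    then show ?thesis by (simp add: \<sigma>_def eval_subst_trm)
  qed
  ultimately show ?thesis unfolding F_def by (auto intro!: exI[of _ e] exI[of _ \<sigma>])
qed

text \<open>A function in \<open>F\<close> is determined by a term, one of countably many, and the
  finite list of its parameters. The default \<open>a 0\<close> past the end of the list is never
  read once the list covers the variables of the term.\<close>

lemma F_lepoll: "F \<lesssim> U"
proof -
  define mk where "mk = (\<lambda>(\<tau> :: 'f trm, ms) x.
    eval M ((\<lambda>v. if v < length ms then ms ! v else a 0)(0 := x)) \<tau>)"
  have "F \<subseteq> mk ` (UNIV \<times> lists U)"
  proof
    fix g assume "g \<in> F"
    then obtain e \<tau> where g: "g = (\<lambda>x. eval M (e(0 := x)) \<tau>)" "asg M e" unfolding F_def by blast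
    obtain k where k: "\<forall>v\<in>vars_trm \<tau>. v < k"
      using finite_nat_set_iff_bounded finite_vars_trm by blast
    have "g = mk (\<tau>, map e [0..<k])"
      unfolding g mk_def using k by (auto intro!: eval_cong)
    moreover have "map e [0..<k] \<in> lists U" using g(2) by (auto simp: asg_def)
    ultimately show "g \<in> mk ` (UNIV \<times> lists U)" by blast
  qed
  then have "F \<lesssim> (UNIV :: 'f trm set) \<times> lists U" by (rule subset_image_lepoll)
  also have "\<dots> \<lesssim> U \<times> U"
  proof (intro times_lepoll_mono infinite_lists_lepoll infinite_U)
    have "(UNIV :: 'f trm set) \<lesssim> (UNIV :: nat set)"
      using countable_trms[OF countable_funs] by (auto simp: countable_def lepoll_def)
    also have "\<dots> \<lesssim> U" using infinite_U by (simp add: infinite_le_lepoll)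
    finally show "(UNIV :: 'f trm set) \<lesssim> U" .
  qed
  also have "\<dots> \<approx> U" by (rule infinite_times_self[OF infinite_U])
  finally show ?thesis .
qed

text \<open>For large \<open>n\<close> the bound \<open>a n\<close> exceeds the finitely many
  parameters and \<open>C n\<close> is indiscernible for \<open>\<phi>\<close>, so the truth value
  is constant on \<open>C n\<close>. This makes the filter an ultrafilter on definable sets.\<close>

lemma ev_decides_params:
  assumes wf: "wf_fm fa pa \<phi>" and e: "asg M e"
  shows "ev (\<lambda>x. sat M (e(0 := x)) \<phi>) \<or> ev (\<lambda>x. \<not> sat M (e(0 := x)) \<phi>)"
proof -
  obtain k where k: "\<forall>n\<ge>k. \<forall>x\<in>C n. \<forall>y\<in>C n. indisc lt M 0 \<phi> (a n) x y"
    using C_indisc[OF wf] by blast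
  have "finite (e ` fv \<phi>)" "e ` fv \<phi> \<subseteq> U" using e finite_fv by (auto simp: asg_def)
  then obtain m where "\<forall>b\<in>e ` fv \<phi>. b \<sqsubset> a m" using finite_below_a by blast
  then have "\<forall>v\<in>fv \<phi> - {0}. e v \<sqsubset> a (max k m)"
    using lss_a_mono[of _ m "max k m"] e by (auto simp: asg_def)
  then have "\<forall>x\<in>C (max k m). \<forall>y\<in>C (max k m). sat M (e(0 := x)) \<phi> \<longleftrightarrow> sat M (e(0 := y)) \<phi>"
    using k e max.cobounded1[of k m] unfolding indisc_def by blast
  then show ?thesis unfolding ev_def by blast
qed

text \<open>A Skolem function for \<open>y\<close> in \<open>\<phi> \<leftrightarrow> y = p\<close> turns \<open>\<phi>\<close> into an equation between terms.\<close>
lemma ev_decides: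
  assumes wf: "wf_fm fa pa \<phi>" and g: "\<And>v. g v \<in> F"
  shows "ev (\<lambda>x. sat M (\<lambda>v. g v x) \<phi>) \<or> ev (\<lambda>x. \<not> sat M (\<lambda>v. g v x) \<phi>)"
proof -
  obtain p where p: "p \<notin> fv \<phi>" using ex_new_if_finite finite_fv infinite_UNIV_nat by blast
  obtain y where y: "y \<notin> insert p (fv \<phi>)"
    using ex_new_if_finite finite_fv finite_insert infinite_UNIV_nat by metis
  obtain \<tau> where \<tau>: "wf_trm fa \<tau>"
    "\<And>e. asg M e \<Longrightarrow> \<exists>b\<in>U. sat M (e(y := b)) (Iff \<phi> (Eq (Var y) (Var p))) \<Longrightarrow>
      sat M (e(y := eval M e \<tau>)) (Iff \<phi> (Eq (Var y) (Var p)))"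
    using skolem[of "Iff \<phi> (Eq (Var y) (Var p))" y] wf by auto
  have char: "sat M e \<phi> \<longleftrightarrow> eval M e \<tau> = e p" if e: "asg M e" for e
  proof -
    have upd: "sat M (e(y := b)) \<phi> \<longleftrightarrow> sat M e \<phi>" for b
      by (rule sat_cong) (use y in auto)
    \<comment> \<open>If \<open>\<phi>\<close> holds, \<open>b\<close> is \<open>e p\<close>;
      otherwise any other element works, and \<open>U\<close> is infinite.\<close>
    have "\<exists>b\<in>U. b = e p \<longleftrightarrow> sat M e \<phi>"
      using e infinite_U by (metis asg_def finite.emptyI finite_insert finite_subset insertI1 subsetI)
    then have "\<exists>b\<in>U. sat M (e(y := b)) (Iff \<phi> (Eq (Var y) (Var p)))"
      using y by (auto simp: upd)
    from \<tau>(2)[OF e this] show ?thesis using y by (simp add: upd)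
  qed
  define h where "h = g(p := \<lambda>_. a 0)"
  have h: "h v \<in> F" for v using g F_const[OF a_in] by (simp add: h_def)
  obtain e \<sigma> where \<sigma>: "(\<lambda>x. eval M (\<lambda>v. h v x) \<tau>) = (\<lambda>x. eval M (e(0 := x)) \<sigma>)" "asg M e" "wf_trm fa \<sigma>"
    using F_eval[OF \<tau>(1), of h] h unfolding F_def by blast
  obtain q where q: "q \<notin> insert 0 (vars_trm \<sigma>)"
    using ex_new_if_finite finite_vars_trm finite_insert infinite_UNIV_nat by metis
  \<comment> \<open>\<open>q\<close> carries the constant that \<open>h\<close> assigns to
    \<open>p\<close>, so \<open>\<sigma> = q\<close> expresses the equation between
    \<open>\<tau>\<close> and \<open>p\<close>.\<close>
  define e' where "e' = e(q := a 0)"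
  have "asg M e'" using \<sigma>(2) a_in by (simp add: e'_def asg_def)
  then have dec: "ev (\<lambda>x. sat M (e'(0 := x)) (Eq \<sigma> (Var q))) \<or> ev (\<lambda>x. \<not> sat M (e'(0 := x)) (Eq \<sigma> (Var q)))"
    using \<sigma>(3) by (intro ev_decides_params) auto
  have eq: "sat M (e'(0 := x)) (Eq \<sigma> (Var q)) \<longleftrightarrow> sat M (\<lambda>v. g v x) \<phi>" if "x \<in> U" for x
  proof -
    have "eval M (e'(0 := x)) \<sigma> = eval M (e(0 := x)) \<sigma>"
      by (rule eval_cong) (use q in \<open>auto simp: e'_def\<close>)
    also have "\<dots> = eval M (\<lambda>v. h v x) \<tau>" using \<sigma>(1) by (rule fun_cong[symmetric])
    finally have "sat M (e'(0 := x)) (Eq \<sigma> (Var q)) \<longleftrightarrow> eval M (\<lambda>v. h v x) \<tau> = h p x"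
      using q by (simp add: e'_def h_def)
    also have "\<dots> \<longleftrightarrow> sat M (\<lambda>v. h v x) \<phi>"
      using char[of "\<lambda>v. h v x"] F_in_U[OF h that] by (simp add: asg_def)
    also have "\<dots> \<longleftrightarrow> sat M (\<lambda>v. g v x) \<phi>"
      by (rule sat_cong) (use p in \<open>auto simp: h_def\<close>)
    finally show ?thesis .
  qed
  from dec show ?thesis by (rule disj_forward) (erule ev_mono, simp del: sat.simps add: eq)+
qed

section \<open>The ultrapower, coded on the type of \<open>M\<close>\<close>

definition rep :: "('a \<Rightarrow> 'a) \<Rightarrow> 'a \<Rightarrow> 'a" where
  "rep f = (SOME g. g \<in> F \<and> ev (\<lambda>x. g x = f x))"

definition code :: "('a \<Rightarrow> 'a) \<Rightarrow> 'a" where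
  "code = (SOME k. inj_on k F \<and> k ` F \<subseteq> U)"

text \<open>The new universe must consist of elements of type \<open>'a\<close>, so a class of
  functions is named by the code in \<open>U\<close> of a chosen member; \<open>dec\<close> recovers
  that member.\<close>

definition cls :: "('a \<Rightarrow> 'a) \<Rightarrow> 'a" where
  "cls f = code (rep f)"

definition dec :: "'a \<Rightarrow> 'a \<Rightarrow> 'a" where
  "dec = inv_into F code"

lemma code: "inj_on code F" "code ` F \<subseteq> U"
  using someI_ex[OF F_lepoll[unfolded lepoll_def]] unfolding code_def by blast+

lemma rep: "f \<in> F \<Longrightarrow> rep f \<in> F" "f \<in> F \<Longrightarrow> ev (\<lambda>x. rep f x = f x)"
proof -
  assume "f \<in> F"
  then have "\<exists>g. g \<in> F \<and> ev (\<lambda>x. g x = f x)" by (intro exI[of _ f]) simp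
  from someI_ex[OF this] show "rep f \<in> F" "ev (\<lambda>x. rep f x = f x)" unfolding rep_def by blast+
qed

lemma cls_in_U: "f \<in> F \<Longrightarrow> cls f \<in> U"
  unfolding cls_def using code(2) rep(1) by blast

lemma dec_cls: "f \<in> F \<Longrightarrow> dec (cls f) = rep f"
  unfolding cls_def dec_def by (simp add: code(1) rep(1))

lemma ev_dec_cls: "f \<in> F \<Longrightarrow> ev (\<lambda>x. dec (cls f) x = f x)"
  by (simp add: dec_cls rep(2))

lemma dec_in_F: "b \<in> cls ` F \<Longrightarrow> dec b \<in> F"
  by (auto simp: dec_cls rep(1))

text \<open>Eventually equal functions give \<open>rep\<close> the same predicate to choose from,
  hence the same representative. Conversely, each function eventually equals its
  representative.\<close>

lemma cls_eq_iff:
  assumes "f \<in> F" "g \<in> F"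
  shows "cls f = cls g \<longleftrightarrow> ev (\<lambda>x. f x = g x)"
proof
  assume "cls f = cls g"
  then have "rep f = rep g" using assms by (metis dec_cls)
  then show "ev (\<lambda>x. f x = g x)"
    using ev_conj[OF rep(2)[OF assms(1)] rep(2)[OF assms(2)]] by (auto elim: ev_mono)
next
  assume *: "ev (\<lambda>x. f x = g x)"
  have "ev (\<lambda>x. h x = f x) \<longleftrightarrow> ev (\<lambda>x. h x = g x)" for h
    by (rule ev_cong) (rule ev_mono[OF *], simp)
  then show "cls f = cls g" by (simp add: cls_def rep_def)
qed

lemma cls_dec: "b \<in> cls ` F \<Longrightarrow> cls (dec b) = b"
  by (auto simp: cls_eq_iff dec_in_F ev_dec_cls)

lemma eq_iff_ev: "b \<in> cls ` F \<Longrightarrow> b' \<in> cls ` F \<Longrightarrow> b = b' \<longleftrightarrow> ev (\<lambda>x. dec b x = dec b' x)"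
  using cls_eq_iff[of "dec b" "dec b'"] dec_in_F by (simp add: cls_dec)

definition N :: "('a, 'f, 'p) struc" where
  "N = \<lparr>univ = cls ` F,
    fint = (\<lambda>f bs. cls (\<lambda>x. fint M f (map (\<lambda>b. dec b x) bs))),
    rint = (\<lambda>p bs. ev (\<lambda>x. rint M p (map (\<lambda>b. dec b x) bs)))\<rparr>"

lemma univ_N: "univ N = cls ` F"
  by (simp add: N_def)

lemma dec_univ_N: "b \<in> univ N \<Longrightarrow> dec b \<in> F"
  by (simp add: univ_N dec_in_F)

lemma F_fint:
  assumes "length bs = fa f" "set bs \<subseteq> univ N"
  shows "(\<lambda>x. fint M f (map (\<lambda>b. dec b x) bs)) \<in> F"
proof -
  \<comment> \<open>Past the end of \<open>bs\<close> the identity is a filler, so that every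
    \<open>g v\<close> lies in \<open>F\<close>.\<close>
  define g where "g v = (if v < length bs then dec (bs ! v) else (\<lambda>x. x))" for v
  have "bs ! v \<in> univ N" if "v < length bs" for v using assms(2) nth_mem[OF that] by blast
  then have "g v \<in> F" for v by (simp add: g_def F_id dec_univ_N)
  then have "(\<lambda>x. eval M (\<lambda>v. g v x) (Fn f (map Var [0..<length bs]))) \<in> F"
    using assms(1) by (intro F_eval) auto
  moreover have "eval M (\<lambda>v. g v x) (Fn f (map Var [0..<length bs])) = fint M f (map (\<lambda>b. dec b x) bs)" for x
  proof -
    have "map (eval M (\<lambda>v. g v x)) (map Var [0..<length bs]) = map (\<lambda>b. dec b x) bs"
      by (rule nth_equalityI) (auto simp: g_def)
    then show ?thesis by (simp only: eval.simps)
  qed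
  ultimately show ?thesis by simp
qed

lemma struc_N: "is_struc fa N"
  unfolding is_struc_def
proof (intro conjI allI impI)
  show "univ N \<noteq> {}" using F_id by (auto simp: univ_N)
  fix f bs assume "length bs = fa f" "set bs \<subseteq> univ N"
  then show "fint N f bs \<in> univ N" using F_fint by (simp add: N_def)
qed

lemma eval_N:
  assumes e: "asg N e" and "wf_trm fa t"
  shows "eval N e t \<in> univ N \<and> ev (\<lambda>x. dec (eval N e t) x = eval M (\<lambda>v. dec (e v) x) t)"
  using assms(2)
proof (induction t)
  case (Var v)
  then show ?case using e by (simp add: asg_def)
next
  case (Fn f ts)
  define bs where "bs = map (eval N e) ts"
  have bs: "length bs = fa f" "set bs \<subseteq> univ N" using Fn by (auto simp: bs_def)
  have 1: "eval N e (Fn f ts) = cls (\<lambda>x. fint M f (map (\<lambda>b. dec b x) bs))"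
    by (simp add: N_def bs_def)
  have "ev (\<lambda>x. \<forall>t\<in>set ts. dec (eval N e t) x = eval M (\<lambda>v. dec (e v) x) t)"
    by (rule ev_ball_finite) (use Fn in auto)
  then have "ev (\<lambda>x. dec (eval N e (Fn f ts)) x = fint M f (map (\<lambda>b. dec b x) bs) \<and>
      (\<forall>t\<in>set ts. dec (eval N e t) x = eval M (\<lambda>v. dec (e v) x) t))"
    unfolding 1 by (rule ev_conj[OF ev_dec_cls[OF F_fint[OF bs]]])
  then have "ev (\<lambda>x. dec (eval N e (Fn f ts)) x = eval M (\<lambda>v. dec (e v) x) (Fn f ts))"
  proof (rule ev_mono)
    fix x assume *: "dec (eval N e (Fn f ts)) x = fint M f (map (\<lambda>b. dec b x) bs) \<and>
      (\<forall>t\<in>set ts. dec (eval N e t) x = eval M (\<lambda>v. dec (e v) x) t)"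
    then have "map (\<lambda>b. dec b x) bs = map (eval M (\<lambda>v. dec (e v) x)) ts" by (simp add: bs_def)
    with * show "dec (eval N e (Fn f ts)) x = eval M (\<lambda>v. dec (e v) x) (Fn f ts)" by simp
  qed
  moreover have "eval N e (Fn f ts) \<in> univ N" unfolding 1 univ_N using F_fint[OF bs] by blast
  ultimately show ?case by blast
qed

text \<open>Negation needs the ultrafilter property \<open>ev_decides\<close>. For the existential
  quantifier, a Skolem term evaluated along the assignment gives a witnessing function in
  \<open>F\<close>.\<close>

lemma Los:
  assumes "asg N e" "wf_fm fa pa \<phi>"
  shows "sat N e \<phi> \<longleftrightarrow> ev (\<lambda>x. sat M (\<lambda>v. dec (e v) x) \<phi>)"
  using assms
proof (induction \<phi> arbitrary: e)
  case (Eq s t)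
  then have wf: "wf_trm fa s" "wf_trm fa t" by auto
  note s = eval_N[OF Eq.prems(1) wf(1)] and t = eval_N[OF Eq.prems(1) wf(2)]
  have "sat N e (Eq s t) \<longleftrightarrow> ev (\<lambda>x. dec (eval N e s) x = dec (eval N e t) x)"
    using eq_iff_ev s t by (simp add: univ_N)
  also have "\<dots> \<longleftrightarrow> ev (\<lambda>x. eval M (\<lambda>v. dec (e v) x) s = eval M (\<lambda>v. dec (e v) x) t)"
    by (rule ev_cong, rule ev_mono[OF ev_conj[OF conjunct2[OF s] conjunct2[OF t]]]) auto
  finally show ?case by simp
next
  case (Rel p ts)
  have "ev (\<lambda>x. \<forall>t\<in>set ts. dec (eval N e t) x = eval M (\<lambda>v. dec (e v) x) t)"
    by (rule ev_ball_finite) (use Rel eval_N in auto)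
  then have "ev (\<lambda>x. rint M p (map (\<lambda>b. dec b x) (map (eval N e) ts)) \<longleftrightarrow>
      rint M p (map (eval M (\<lambda>v. dec (e v) x)) ts))"
  proof (rule ev_mono)
    fix x assume "\<forall>t\<in>set ts. dec (eval N e t) x = eval M (\<lambda>v. dec (e v) x) t"
    then have "map (\<lambda>b. dec b x) (map (eval N e) ts) = map (eval M (\<lambda>v. dec (e v) x)) ts" by simp
    then show "rint M p (map (\<lambda>b. dec b x) (map (eval N e) ts)) \<longleftrightarrow>
      rint M p (map (eval M (\<lambda>v. dec (e v) x)) ts)" by (simp only:)
  qed
  from ev_cong[OF this] show ?case by (simp add: N_def)
next
  case (Neg \<phi>)
  then have "sat N e (Neg \<phi>) \<longleftrightarrow> \<not> ev (\<lambda>x. sat M (\<lambda>v. dec (e v) x) \<phi>)" by simp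
  also have "\<dots> \<longleftrightarrow> ev (\<lambda>x. \<not> sat M (\<lambda>v. dec (e v) x) \<phi>)"
    using ev_decides[of \<phi> "\<lambda>v. dec (e v)"] Neg.prems ev_not dec_univ_N by (auto simp: asg_def)
  finally show ?case by simp
next
  case (Conj \<phi> \<psi>)
  then have "sat N e (Conj \<phi> \<psi>) \<longleftrightarrow>
      ev (\<lambda>x. sat M (\<lambda>v. dec (e v) x) \<phi>) \<and> ev (\<lambda>x. sat M (\<lambda>v. dec (e v) x) \<psi>)" by simp
  also have "\<dots> \<longleftrightarrow> ev (\<lambda>x. sat M (\<lambda>v. dec (e v) x) \<phi> \<and> sat M (\<lambda>v. dec (e v) x) \<psi>)"
    using ev_conj by (auto elim: ev_mono)
  finally show ?case by simp
next
  case (Ex w \<phi>)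
  have wf: "wf_fm fa pa \<phi>" using Ex.prems by simp
  have upd: "(\<lambda>v. dec ((e(w := b)) v) x) = (\<lambda>v. dec (e v) x)(w := dec b x)" for b x by auto
  have asg: "asg M (\<lambda>v. dec (e v) x)" if "x \<in> U" for x
    using Ex.prems(1) that F_in_U dec_univ_N unfolding asg_def by blast
  have IH: "sat N (e(w := b)) \<phi> \<longleftrightarrow> ev (\<lambda>x. sat M ((\<lambda>v. dec (e v) x)(w := dec b x)) \<phi>)"
    if "b \<in> univ N" for b
    using Ex.IH[OF asg_upd[OF Ex.prems(1) that, of w] wf] unfolding upd .
  show ?case
  proof
    assume "sat N e (Ex w \<phi>)"
    then obtain b where b: "b \<in> univ N" "sat N (e(w := b)) \<phi>" by auto
    then have "ev (\<lambda>x. sat M ((\<lambda>v. dec (e v) x)(w := dec b x)) \<phi>)" using IH by blast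
    then show "ev (\<lambda>x. sat M (\<lambda>v. dec (e v) x) (Ex w \<phi>))"
      by (rule ev_mono) (use F_in_U dec_univ_N b in auto)
  next
    assume *: "ev (\<lambda>x. sat M (\<lambda>v. dec (e v) x) (Ex w \<phi>))"
    obtain \<tau> where \<tau>: "wf_trm fa \<tau>" "\<And>e. asg M e \<Longrightarrow> \<exists>b\<in>U. sat M (e(w := b)) \<phi> \<Longrightarrow>
      sat M (e(w := eval M e \<tau>)) \<phi>" using skolem[OF wf, of w] by blast
    define g where "g x = eval M (\<lambda>v. dec (e v) x) \<tau>" for x
    have "g \<in> F" unfolding g_def
      by (rule F_eval[OF \<tau>(1)]) (use Ex.prems dec_univ_N in \<open>auto simp: asg_def\<close>)
    have "ev (\<lambda>x. sat M ((\<lambda>v. dec (e v) x)(w := g x)) \<phi>)"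
      using * by (rule ev_mono) (use \<tau>(2) asg in \<open>auto simp: g_def\<close>)
    from ev_conj[OF this ev_dec_cls[OF \<open>g \<in> F\<close>]]
    have "ev (\<lambda>x. sat M ((\<lambda>v. dec (e v) x)(w := dec (cls g) x)) \<phi>)"
      by (rule ev_mono) auto
    then have "sat N (e(w := cls g)) \<phi>" using IH \<open>g \<in> F\<close> by (simp add: univ_N)
    then show "sat N e (Ex w \<phi>)" using \<open>g \<in> F\<close> by (auto simp: univ_N)
  qed
qed

section \<open>The embedding by constant functions and the end extension property\<close>

lemma less_N: "less lt N b b' \<longleftrightarrow> ev (\<lambda>x. dec b x \<sqsubset> dec b' x)"
  by (simp add: less_def N_def)

abbreviation emb :: "'a \<Rightarrow> 'a" where "emb b \<equiv> cls (\<lambda>_. b)"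

lemma ev_dec_emb: "b \<in> U \<Longrightarrow> ev (\<lambda>x. dec (emb b) x = b)"
  by (rule ev_dec_cls[OF F_const])

lemma emb_elementary: "elem_embedding fa pa emb M N"
  unfolding elem_embedding_def
proof (intro conjI allI impI)
  show "emb ` U \<subseteq> univ N" using F_const by (auto simp: univ_N)
  fix \<phi> :: "('f, 'p) fm" and e :: "nat \<Rightarrow> 'a" assume \<phi>: "wf_fm fa pa \<phi>" and e: "asg M e"
  have "asg N (emb \<circ> e)" using e F_const by (auto simp: asg_def univ_N)
  then have "sat N (emb \<circ> e) \<phi> \<longleftrightarrow> ev (\<lambda>x. sat M (\<lambda>v. dec (emb (e v)) x) \<phi>)"
    using Los \<phi> by simp
  also have "\<dots> \<longleftrightarrow> ev (\<lambda>x. sat M e \<phi>)"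
  proof (rule ev_cong)
    \<comment> \<open>Restricting to the free variables leaves finitely many conditions, which the
      filter can meet at once.\<close>
    have "ev (\<lambda>x. \<forall>v\<in>fv \<phi>. dec (emb (e v)) x = e v)"
      by (rule ev_ball_finite) (use e ev_dec_emb finite_fv in \<open>auto simp: asg_def\<close>)
    then show "ev (\<lambda>x. sat M (\<lambda>v. dec (emb (e v)) x) \<phi> \<longleftrightarrow> sat M e \<phi>)"
      by (rule ev_mono) (rule sat_cong, blast)
  qed
  finally show "sat M e \<phi> \<longleftrightarrow> sat N (emb \<circ> e) \<phi>" by simp
qed

text \<open>Let \<open>w\<close> be the value of \<open>dec b\<close> at one point of
  \<open>C n\<close>, with \<open>n\<close> large. It is below \<open>c\<close>, hence below
  \<open>a n\<close>, so it is an admissible parameter in the formula \<open>\<tau> = q\<close>;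
  indiscernibility then forces the value \<open>w\<close> on all of \<open>C n\<close>.\<close>

lemma end_extension:
  assumes b: "b \<in> univ N" and c: "c \<in> U" and less: "less lt N b (emb c)"
  shows "b \<in> emb ` U"
proof -
  have F: "dec b \<in> F" using b by (rule dec_univ_N)
  obtain e \<tau> where \<tau>: "dec b = (\<lambda>x. eval M (e(0 := x)) \<tau>)" "asg M e" "wf_trm fa \<tau>"
    using F unfolding F_def by blast
  obtain q where q: "q \<notin> insert 0 (vars_trm \<tau>)"
    using ex_new_if_finite finite_vars_trm finite_insert infinite_UNIV_nat by metis
  have "wf_fm fa pa (Eq \<tau> (Var q))" using \<tau>(3) by simp
  from C_indisc[OF this] obtain k where
    k: "\<And>n x y. k \<le> n \<Longrightarrow> x \<in> C n \<Longrightarrow> y \<in> C n \<Longrightarrow> indisc lt M 0 (Eq \<tau> (Var q)) (a n) x y" by blast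
  have "ev (\<lambda>x. dec b x \<sqsubset> c)"
    using ev_conj[OF less[unfolded less_N] ev_dec_emb[OF c]] by (rule ev_mono) auto
  then obtain j where j: "\<And>x. x \<in> C j \<Longrightarrow> dec b x \<sqsubset> c" unfolding ev_def by blast
  have "finite (insert c (e ` vars_trm \<tau>))" "insert c (e ` vars_trm \<tau>) \<subseteq> U"
    using \<tau>(2) c finite_vars_trm by (auto simp: asg_def)
  then obtain i where i: "\<forall>x\<in>insert c (e ` vars_trm \<tau>). x \<sqsubset> a i" using finite_below_a by blast
  define n where "n = max i (max j k)"
  have n: "i \<le> n" "j \<le> n" "k \<le> n" by (auto simp: n_def)
  obtain x0 where x0: "x0 \<in> C n" using C_unbounded[OF a_in] by blast
  define w where "w = dec b x0"
  have w: "w \<in> U" "w \<sqsubset> a n"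
  proof -
    show "w \<in> U" unfolding w_def using F_in_U[OF F] x0 C_sub by blast
    have "w \<sqsubset> c" using j x0 C_antimono[OF n(2)] by (auto simp: w_def)
    moreover have "c \<sqsubset> a n" using i lss_a_mono[OF _ c n(1)] by blast
    ultimately show "w \<sqsubset> a n" using \<open>w \<in> U\<close> c a_in lss_trans by blast
  qed
  have "dec b y = w" if y: "y \<in> C n" for y
  proof -
    have val: "sat M ((e(q := w))(0 := x)) (Eq \<tau> (Var q)) \<longleftrightarrow> dec b x = w" for x
    proof -
      have "eval M ((e(q := w))(0 := x)) \<tau> = eval M (e(0 := x)) \<tau>"
        by (rule eval_cong) (use q in auto)
      then show ?thesis using q by (simp add: \<tau>(1))
    qed
    have "asg M (e(q := w))" using \<tau>(2) w by (simp add: asg_def)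
    moreover have "\<forall>v\<in>fv (Eq \<tau> (Var q)) - {0}. (e(q := w)) v \<sqsubset> a n"
      using i w lss_a_mono[OF _ _ n(1)] \<tau>(2) by (auto simp: asg_def)
    ultimately have "sat M ((e(q := w))(0 := x0)) (Eq \<tau> (Var q)) \<longleftrightarrow>
        sat M ((e(q := w))(0 := y)) (Eq \<tau> (Var q))"
      using k[OF n(3) x0 y] unfolding indisc_def by blast
    then have "dec b x0 = w \<longleftrightarrow> dec b y = w" by (simp only: val)
    then show ?thesis by (simp add: w_def)
  qed
  then have "ev (\<lambda>x. dec b x = w)" unfolding ev_def by blast
  then have "cls (dec b) = emb w" using cls_eq_iff[OF F F_const[OF w(1)]] by simp
  then show ?thesis using b w(1) by (simp add: cls_dec univ_N)
qed

lemma emb_proper: "emb ` U \<noteq> univ N"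
proof
  assume "emb ` U = univ N"
  then have "cls (\<lambda>x. x) \<in> emb ` U" using F_id by (simp add: univ_N)
  then show False using cls_eq_iff[OF F_id F_const] ev_above by auto
qed

section \<open>Cardinality, order and countable cofinality of \<open>N\<close>\<close>

lemma univ_N_eqpoll: "univ N \<approx> U"
proof (rule lepoll_antisym)
  show "univ N \<lesssim> U" using cls_in_U by (intro subset_imp_lepoll) (auto simp: univ_N)
  show "U \<lesssim> univ N" unfolding lepoll_def
    by (intro exI[of _ emb]) (auto simp: inj_on_def univ_N cls_eq_iff F_const)
qed

text \<open>Irreflexivity and transitivity follow from the filter laws. Totality is a disjunction,
  which \<open>Los\<close> distributes over the ultrafilter.\<close>

lemma linear_N: "linear_order_in lt N"
  unfolding linear_order_in_def
proof (intro conjI ballI impI)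
  fix x assume x: "x \<in> univ N"
  have "ev (\<lambda>y. \<not> dec x y \<sqsubset> dec x y)"
    by (rule ev_all) (use lss_irrefl F_in_U dec_univ_N[OF x] in blast)
  then show "\<not> less lt N x x" unfolding less_N by (rule ev_not)
next
  fix x y z assume *: "x \<in> univ N" "y \<in> univ N" "z \<in> univ N" "less lt N x y" "less lt N y z"
  show "less lt N x z"
    using ev_conj[OF *(4,5)[unfolded less_N]] unfolding less_N
    by (rule ev_mono) (use lss_trans F_in_U *(1-3)[THEN dec_univ_N] in blast)
next
  fix x y assume xy: "x \<in> univ N" "y \<in> univ N"
  define \<phi> :: "('f, 'p) fm" where
    "\<phi> = Or (Rel lt [Var 0, Var 1]) (Or (Eq (Var 0) (Var 1)) (Rel lt [Var 1, Var 0]))"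
  define e where "e v = (if v = 0 then x else y)" for v :: nat
  have "asg N e" "wf_fm fa pa \<phi>" using xy lt_binary by (auto simp: asg_def e_def \<phi>_def)
  moreover have "ev (\<lambda>z. sat M (\<lambda>v. dec (e v) z) \<phi>)"
    by (rule ev_all) (use lss_total F_in_U xy[THEN dec_univ_N] in \<open>auto simp: \<phi>_def e_def less_def\<close>)
  ultimately have "sat N e \<phi>" using Los by blast
  then show "less lt N x y \<or> x = y \<or> less lt N y x" by (simp add: \<phi>_def e_def less_def)
qed

lemma no_max_N: "b \<in> univ N \<Longrightarrow> \<exists>b'\<in>univ N. less lt N b b'"
proof -
  assume b: "b \<in> univ N"
  define \<phi> :: "('f, 'p) fm" where "\<phi> = Ex 1 (Rel lt [Var 0, Var 1])"
  have "asg N (\<lambda>_. b)" "wf_fm fa pa \<phi>" using b lt_binary by (auto simp: asg_def \<phi>_def)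
  moreover have "ev (\<lambda>z. sat M (\<lambda>v. dec b z) \<phi>)"
  proof (rule ev_all)
    fix x assume "x \<in> U"
    then obtain n where "dec b x \<sqsubset> a n" using a_cofinal F_in_U[OF dec_univ_N[OF b]] by blast
    then show "sat M (\<lambda>v. dec b x) \<phi>" using a_in[of n] by (auto simp: \<phi>_def less_def)
  qed
  ultimately have "sat N (\<lambda>_. b) \<phi>" using Los[of "\<lambda>_. b" \<phi>] by blast
  then show ?thesis by (auto simp: \<phi>_def less_def)
qed

text \<open>By \<open>collection\<close>, \<open>sup {\<tau>(x, m) | m < z}\<close> is bounded by a Skolem term in \<open>x\<close> and \<open>z\<close>; taking
  \<open>z = a n\<close> leaves countably many bounds.\<close>
lemma uniform_bound:
  assumes wf: "wf_trm fa \<tau>"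
  shows "\<exists>g\<in>F. \<forall>e x. asg M e \<longrightarrow> x \<in> U \<longrightarrow> (\<forall>v\<in>vars_trm \<tau> - {0}. e v \<sqsubset> a n) \<longrightarrow>
    eval M (e(0 := x)) \<tau> \<sqsubset> g x"
proof -
  obtain K where K: "0 < K" "\<And>v. v \<in> vars_trm \<tau> \<Longrightarrow> v < K"
    using finite_nat_set_iff_bounded[of "insert 0 (vars_trm \<tau>)"] finite_vars_trm[of \<tau>] by auto
  obtain ts where ts: "set ts = vars_trm \<tau> - {0}"
    using finite_list finite_vars_trm by (metis finite_Diff)
  define w where "w = Suc K"
  define \<beta> :: "('f, 'p) fm" where "\<beta> = Ball_below lt ts K (Rel lt [\<tau>, Var w])"
  have fresh: "K \<notin> set ts" "w \<notin> set ts" "w \<notin> vars_trm \<tau>" "w \<noteq> K" "w \<noteq> 0" "K \<noteq> 0"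
    using K(1) K(2)[of K] K(2)[of w] by (auto simp: ts w_def)
  have sat_\<beta>: "sat M e \<beta> \<longleftrightarrow> (\<forall>e'. asg M e' \<longrightarrow> (\<forall>v. v \<notin> set ts \<longrightarrow> e' v = e v) \<longrightarrow>
      (\<forall>v\<in>set ts. e' v \<sqsubset> e K) \<longrightarrow> eval M e' \<tau> \<sqsubset> e w)" if "asg M e" for e
    unfolding \<beta>_def sat_Ball_below[OF fresh(1) that] using fresh(2) by (auto simp: less_def)
  have "wf_fm fa pa \<beta>" unfolding \<beta>_def using wf lt_binary by (intro wf_Ball_below) auto
  then obtain \<sigma> where \<sigma>: "wf_trm fa \<sigma>" "\<And>e. asg M e \<Longrightarrow> \<exists>b\<in>U. sat M (e(w := b)) \<beta> \<Longrightarrow>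
      sat M (e(w := eval M e \<sigma>)) \<beta>" using skolem[of \<beta> w] by blast
  \<comment> \<open>Setting every variable to \<open>a n\<close> gives \<open>K\<close> the intended
    bound and fixes any further variable of \<open>\<sigma>\<close>, so \<open>g\<close> is
    independent of the assignment \<open>e\<close>.\<close>
  define e0 where "e0 = (\<lambda>_ :: nat. a n)"
  have e0: "asg M e0" using a_in by (simp add: e0_def asg_def)
  define g where "g x = eval M (e0(0 := x)) \<sigma>" for x
  have "g \<in> F" unfolding F_def g_def using e0 \<sigma>(1) by blast
  moreover have "eval M (e(0 := x)) \<tau> \<sqsubset> g x"
    if e: "asg M e" "\<forall>v\<in>vars_trm \<tau> - {0}. e v \<sqsubset> a n" and x: "x \<in> U" for e x
  proof -
    define e1 where "e1 = e0(0 := x)"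
    have e1: "asg M e1" unfolding e1_def by (rule asg_upd[OF e0 x])
    have e1_at: "e1 K = a n" "e1 0 = x" using fresh by (auto simp: e1_def e0_def)
    have gx: "g x \<in> U" using F_in_U[OF \<open>g \<in> F\<close> x] .
    \<comment> \<open>Variable \<open>0\<close> may take the value \<open>x\<close>, so
      \<open>z\<close> has to exceed \<open>x\<close> as well as \<open>a n\<close>. The resulting
      \<open>b\<close> only shows that a bound exists at \<open>x\<close>; the Skolem term makes the
      choice uniform in \<open>x\<close>.\<close>
    obtain z where z: "z \<in> U" "a n \<sqsubset> z" "x \<sqsubset> z"
    proof -
      obtain m where "\<forall>y\<in>{a n, x}. y \<sqsubset> a m" using finite_below_a[of "{a n, x}"] x a_in by auto
      then show thesis using that[of "a m"] a_in by blast
    qed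
    obtain b where b: "b \<in> U" "\<And>e. asg M e \<Longrightarrow> \<forall>v\<in>vars_trm \<tau>. e v \<sqsubset> z \<Longrightarrow> eval M e \<tau> \<sqsubset> b"
      using collection[OF wf z(1)] by blast
    have "sat M (e1(w := b)) \<beta>"
      unfolding sat_\<beta>[OF asg_upd[OF e1 b(1)]]
    proof (intro allI impI)
      fix e' assume e': "asg M e'" "\<forall>v. v \<notin> set ts \<longrightarrow> e' v = (e1(w := b)) v"
        "\<forall>v\<in>set ts. e' v \<sqsubset> (e1(w := b)) K"
      have "e' v \<sqsubset> z" if v: "v \<in> vars_trm \<tau>" for v
      proof (cases "v = 0")
        case True
        then have "e' v = x" using e'(2) fresh e1_at ts by auto
        then show ?thesis using z by simp
      next
        case False
        then have "e' v \<sqsubset> a n" using e'(3) v fresh e1_at ts by auto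
        then show ?thesis using z a_in e'(1) lss_trans unfolding asg_def by blast
      qed
      then have "eval M e' \<tau> \<sqsubset> b" using b(2) e'(1) by blast
      then show "eval M e' \<tau> \<sqsubset> (e1(w := b)) w" by simp
    qed
    then have "sat M (e1(w := g x)) \<beta>"
      using \<sigma>(2)[OF e1] b(1) unfolding g_def e1_def by blast
    note bound = this[unfolded sat_\<beta>[OF asg_upd[OF e1 gx]], rule_format]
    define e' where "e' v = (if v \<in> set ts then e v else (e1(w := g x)) v)" for v
    have "eval M e' \<tau> \<sqsubset> (e1(w := g x)) w"
    proof (rule bound)
      show "asg M e'" using e(1) asg_upd[OF e1 gx] by (simp add: e'_def asg_def)
      show "e' v = (e1(w := g x)) v" if "v \<notin> set ts" for v using that by (simp add: e'_def)
      show "e' v \<sqsubset> (e1(w := g x)) K" if "v \<in> set ts" for v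
        using that e(2) fresh(4) e1_at by (auto simp: e'_def ts)
    qed
    moreover have "eval M e' \<tau> = eval M (e(0 := x)) \<tau>"
      by (rule eval_cong) (use fresh e1_at in \<open>auto simp: e'_def ts\<close>)
    ultimately show ?thesis by simp
  qed
  ultimately show ?thesis by blast
qed

text \<open>There is one bound for each pair of a term and an index, hence countably many; the
  finitely many parameters of a given element lie below some \<open>a n\<close>.\<close>

lemma countable_cofinal_N: "\<exists>D \<subseteq> univ N. countable D \<and> D \<noteq> {} \<and> (\<forall>b\<in>univ N. \<exists>d\<in>D. less lt N b d)"
proof -
  \<comment> \<open>For ill-formed terms the condition is only membership in \<open>F\<close>, which
    the identity meets, so the choice can range over all pairs.\<close>
  have "\<forall>p. \<exists>g. g \<in> F \<and> (wf_trm fa (fst p) \<longrightarrow> (\<forall>e x. asg M e \<longrightarrow> x \<in> U \<longrightarrow>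
    (\<forall>v\<in>vars_trm (fst p) - {0}. e v \<sqsubset> a (snd p)) \<longrightarrow> eval M (e(0 := x)) (fst p) \<sqsubset> g x))"
    using uniform_bound F_id by blast
  from choice[OF this] obtain G :: "'f trm \<times> nat \<Rightarrow> 'a \<Rightarrow> 'a" where G: "\<And>p. G p \<in> F"
    "\<And>\<tau> n e x. wf_trm fa \<tau> \<Longrightarrow> asg M e \<Longrightarrow> x \<in> U \<Longrightarrow> \<forall>v\<in>vars_trm \<tau> - {0}. e v \<sqsubset> a n \<Longrightarrow>
      eval M (e(0 := x)) \<tau> \<sqsubset> G (\<tau>, n) x"
    by (metis fst_conv snd_conv)
  define D where "D = range (\<lambda>p. cls (G p))"
  have "countable (UNIV :: ('f trm \<times> nat) set)"
    using countable_trms[OF countable_funs] by (metis UNIV_Times_UNIV countable_SIGMA countableI_type)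
  then have "countable D" unfolding D_def by (rule countable_image)
  moreover have "D \<subseteq> univ N" "D \<noteq> {}" using G(1) by (auto simp: D_def univ_N)
  moreover have "\<exists>d\<in>D. less lt N b d" if b: "b \<in> univ N" for b
  proof -
    obtain e \<tau> where \<tau>: "dec b = (\<lambda>x. eval M (e(0 := x)) \<tau>)" "asg M e" "wf_trm fa \<tau>"
      using dec_univ_N[OF b] unfolding F_def by blast
    have "finite (e ` vars_trm \<tau>)" "e ` vars_trm \<tau> \<subseteq> U"
      using \<tau>(2) finite_vars_trm by (auto simp: asg_def)
    then obtain n where n: "\<forall>x\<in>e ` vars_trm \<tau>. x \<sqsubset> a n" using finite_below_a by blast
    have "dec b x \<sqsubset> G (\<tau>, n) x" if "x \<in> U" for x
      unfolding \<tau>(1) using G(2)[OF \<tau>(3,2) that] n by auto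
    then have "ev (\<lambda>x. dec b x \<sqsubset> dec (cls (G (\<tau>, n))) x)"
      using ev_dec_cls[OF G(1)[of "(\<tau>, n)"]] by (auto elim: ev_mono)
    then show ?thesis unfolding less_N D_def by blast
  qed
  ultimately show ?thesis by blast
qed

end

section \<open>Cofinality\<close>

text \<open>An increasing sequence is chosen so that its \<open>n\<close>-th term exceeds the
  \<open>n\<close>-th term of an enumeration of \<open>D\<close>. A finite cofinal sequence would
  end in a maximum.\<close>

lemma cof_omega_if_countable_cofinal:
  assumes lin: "linear_order_in lt S"
    and no_max: "\<And>b. b \<in> univ S \<Longrightarrow> \<exists>c\<in>univ S. less lt S b c"
    and D: "D \<subseteq> univ S" "countable D" "D \<noteq> {}" "\<And>b. b \<in> univ S \<Longrightarrow> \<exists>d\<in>D. less lt S b d"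
  shows "cof_omega lt S"
proof -
  have irrefl: "\<not> less lt S x x" if "x \<in> univ S" for x
    using lin that unfolding linear_order_in_def by blast
  have trans: "less lt S x z"
    if "less lt S x y" "less lt S y z" "x \<in> univ S" "y \<in> univ S" "z \<in> univ S" for x y z
    using lin that unfolding linear_order_in_def by blast
  have total: "less lt S x y \<or> x = y \<or> less lt S y x" if "x \<in> univ S" "y \<in> univ S" for x y
    using lin that unfolding linear_order_in_def by blast
  have upper: "\<exists>w\<in>univ S. less lt S x w \<and> less lt S y w" if xy: "x \<in> univ S" "y \<in> univ S" for x y
  proof -
    obtain x' y' where "x' \<in> univ S" "less lt S x x'" "y' \<in> univ S" "less lt S y y'"
      using no_max xy by blast
    then show ?thesis using total[of x y] trans xy by blast
  qed
  define q where "q = from_nat_into D"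
  have q: "q n \<in> univ S" for n using from_nat_into[OF D(3), of n] D(1) by (auto simp: q_def)
  have "\<exists>s. \<forall>n. (s n \<in> univ S \<and> less lt S (q n) (s n)) \<and> less lt S (s n) (s (Suc n))"
  proof (rule dependent_nat_choice)
    show "\<exists>x. x \<in> univ S \<and> less lt S (q 0) x" using no_max[OF q] by blast
    show "\<exists>y. (y \<in> univ S \<and> less lt S (q (Suc n)) y) \<and> less lt S x y"
      if "x \<in> univ S \<and> less lt S (q n) x" for x n
      using upper[of x "q (Suc n)"] that q by blast
  qed
  then obtain s where s: "\<And>n. s n \<in> univ S" "\<And>n. less lt S (q n) (s n)"
    "\<And>n. less lt S (s n) (s (Suc n))" by blast
  have "less lt S (s i) (s j)" if "i < j" for i j
    using that by (induction j) (auto simp: less_Suc_eq s intro: trans[OF _ s(3)])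
  moreover have "\<exists>i. less lt S b (s i)" if b: "b \<in> univ S" for b
  proof -
    obtain d where "d \<in> D" "less lt S b d" using D(4)[OF b] by blast
    moreover obtain i where "d = q i" using from_nat_into_surj[OF D(2) \<open>d \<in> D\<close>] by (auto simp: q_def)
    ultimately show ?thesis using trans[OF _ s(2) b q s(1)] by blast
  qed
  ultimately have "cofinal_seq lt S UNIV s" using s(1) unfolding cofinal_seq_def by blast
  moreover have "\<not> cofinal_seq lt S {..<n} r" for n :: nat and r
  proof
    assume "cofinal_seq lt S {..<n} r"
    then have r: "\<And>i. i < n \<Longrightarrow> r i \<in> univ S" "\<And>i j. i < j \<Longrightarrow> j < n \<Longrightarrow> less lt S (r i) (r j)"
      "\<And>b. b \<in> univ S \<Longrightarrow> \<exists>i<n. less lt S b (r i) \<or> b = r i"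
      unfolding cofinal_seq_def by auto
    \<comment> \<open>Cofinality at any element makes \<open>n\<close> positive, so
      \<open>n - 1\<close> is a genuine last index.\<close>
    obtain i where "i < n" using r(3)[OF q] by blast
    then have last: "n - 1 < n" by simp
    obtain c where c: "c \<in> univ S" "less lt S (r (n - 1)) c" using no_max[OF r(1)[OF last]] by blast
    obtain j where j: "j < n" "less lt S c (r j) \<or> c = r j" using r(3)[OF c(1)] by blast
    have "less lt S (r (n - 1)) (r j)" using j c trans r(1) last by blast
    moreover have "j = n - 1 \<or> less lt S (r j) (r (n - 1))" using r(2)[OF _ last, of j] j(1) by (cases "j < n - 1") auto
    ultimately show False using trans irrefl r(1) last j(1) by metis
  qed
  ultimately show ?thesis unfolding cof_omega_def by blast
qed

section \<open>Transfer of the hypotheses on \<open>T\<close> to \<open>M\<close>, and assembly of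
  the extension\<close>

theorem theorem1p2:
  fixes fa :: "'f \<Rightarrow> nat" and pa :: "'p \<Rightarrow> nat" and lt :: 'p
    and T :: "('f, 'p) fm set" and M :: "('a, 'f, 'p) struc"
  assumes countable_L: "countable (UNIV :: 'f set)" "countable (UNIV :: 'p set)"
    and lt_binary: "pa lt = 2"
    and complete: "complete_theory TYPE('a) fa pa T"
    and skolem: "has_skolem_functions TYPE('a) fa pa T"
    and linear: "entails TYPE('a) fa pa T (linear_order_in lt)"
    and inacc: "inaccessibility_scheme TYPE('a) fa pa lt T"
    and model: "is_model fa pa M T"
    and cof: "cof_omega lt M"
  shows "\<exists>(N :: ('a, 'f, 'p) struc) h. is_struc fa N \<and> elem_end_extension fa pa lt h M N \<and>
           univ N \<approx> univ M \<and> cof_omega lt N"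
proof -
  have lin: "linear_order_in lt M" using linear model unfolding entails_def by blast
  have sk: "\<exists>\<tau>. wf_trm fa \<tau> \<and> (\<forall>e. asg M e \<longrightarrow>
      (\<exists>b\<in>univ M. sat M (e(y := b)) \<theta>) \<longrightarrow> sat M (e(y := eval M e \<tau>)) \<theta>)"
    if wf: "wf_fm fa pa \<theta>" for \<theta> y
  proof -
    define xs where "xs = sorted_list_of_set (fv \<theta> - {y})"
    have xs: "set xs = fv \<theta> - {y}" "distinct xs" using finite_fv[of \<theta>] by (simp_all add: xs_def)
    then have "distinct (y # xs)" "fv \<theta> \<subseteq> insert y (set xs)" by auto
    then obtain \<tau> where "wf_trm fa \<tau>"
      "entails TYPE('a) fa pa T (\<lambda>S. \<forall>e. asg S e \<longrightarrow>
        (\<exists>a\<in>univ S. sat S (e(y := a)) \<theta>) \<longrightarrow> sat S (e(y := eval S e \<tau>)) \<theta>)"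
      using skolem wf unfolding has_skolem_functions_def by blast
    then show ?thesis using model unfolding entails_def by blast
  qed
  have sch: "\<exists>z1\<in>univ M. less lt M z z1 \<and>
      (\<forall>y\<in>univ M. \<exists>y1\<in>univ M. less lt M y1 z1 \<and> indisc lt M u \<phi> z y y1)"
    if wf: "wf_fm fa pa \<phi>" and z: "z \<in> univ M" for \<phi> z u
  proof -
    \<comment> \<open>The scheme is used with \<open>u\<close> alone as the first tuple and the
      other free variables as the second.\<close>
    define ts where "ts = sorted_list_of_set (fv \<phi> - {u})"
    have ts: "set ts = fv \<phi> - {u}" "distinct ts" using finite_fv[of \<phi>] by (simp_all add: ts_def)
    then have "distinct ([u] @ ts)" "fv \<phi> \<subseteq> set [u] \<union> set ts" by auto
    with inacc wf have "entails TYPE('a) fa pa T (\<lambda>S. \<forall>e. asg S e \<longrightarrow>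
          (\<forall>z0\<in>univ S. \<exists>z1\<in>univ S. less lt S z0 z1 \<and>
             (\<forall>y0. tuple S (length [u]) y0 \<longrightarrow>
                (\<exists>y1. tuple S (length [u]) y1 \<and> all_below lt S y1 z1 \<and>
                   (\<forall>t. tuple S (length ts) t \<longrightarrow> all_below lt S t z0 \<longrightarrow>
                      (sat S (updl e ([u] @ ts) (y0 @ t)) \<phi> \<longleftrightarrow>
                       sat S (updl e ([u] @ ts) (y1 @ t)) \<phi>))))))"
      unfolding inaccessibility_scheme_def by blast
    \<comment> \<open>Instantiating one fixed assignment keeps \<open>z1\<close> independent of the
      later \<open>e\<close>; \<open>updl\<close> overwrites all free variables of
      \<open>\<phi>\<close> anyway.\<close>
    moreover have "asg M (\<lambda>_. z)" using z by (simp add: asg_def)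
    ultimately obtain z1 where z1: "z1 \<in> univ M" "less lt M z z1"
      "\<And>y0. tuple M (length [u]) y0 \<Longrightarrow> \<exists>y1. tuple M (length [u]) y1 \<and> all_below lt M y1 z1 \<and>
        (\<forall>t. tuple M (length ts) t \<longrightarrow> all_below lt M t z \<longrightarrow>
          (sat M (updl (\<lambda>_. z) ([u] @ ts) (y0 @ t)) \<phi> \<longleftrightarrow>
           sat M (updl (\<lambda>_. z) ([u] @ ts) (y1 @ t)) \<phi>))"
      using model z unfolding entails_def by blast
    have "\<exists>y1\<in>univ M. less lt M y1 z1 \<and> indisc lt M u \<phi> z y y1" if y: "y \<in> univ M" for y
    proof -
      have "tuple M (length [u]) [y]" using y by (simp add: tuple_def)
      from z1(3)[OF this] obtain l where l: "tuple M (length [u]) l" "all_below lt M l z1"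
        "\<And>t. tuple M (length ts) t \<Longrightarrow> all_below lt M t z \<Longrightarrow>
          (sat M (updl (\<lambda>_. z) ([u] @ ts) ([y] @ t)) \<phi> \<longleftrightarrow>
           sat M (updl (\<lambda>_. z) ([u] @ ts) (l @ t)) \<phi>)" by blast
      obtain y1 where y1: "l = [y1]" using l(1) by (auto simp: tuple_def length_Suc_conv)
      have "indisc lt M u \<phi> z y y1" unfolding indisc_def
      proof (intro allI impI)
        fix e assume e: "asg M e" "\<forall>v\<in>fv \<phi> - {u}. less lt M (e v) z"
        have upd: "sat M (updl (\<lambda>_. z) ([u] @ ts) ([x] @ map e ts)) \<phi> \<longleftrightarrow> sat M (e(u := x)) \<phi>" for x
          by (rule sat_cong) (auto simp: updl_apply ts(1))
        have "tuple M (length ts) (map e ts)" "all_below lt M (map e ts) z"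
          using e by (auto simp: tuple_def all_below_def asg_def ts(1))
        from l(3)[OF this] show "sat M (e(u := y)) \<phi> \<longleftrightarrow> sat M (e(u := y1)) \<phi>"
          unfolding y1 upd .
      qed
      then show ?thesis using l(1,2) by (auto simp: y1 tuple_def all_below_def)
    qed
    then show ?thesis using z1(1,2) by blast
  qed
  obtain a :: "nat \<Rightarrow> 'a" where "cofinal_seq lt M UNIV a" using cof unfolding cof_omega_def by blast
  then have a: "\<And>n. a n \<in> univ M" "\<And>n. less lt M (a n) (a (Suc n))"
    "\<And>b. b \<in> univ M \<Longrightarrow> \<exists>i. less lt M b (a i) \<or> b = a i"
    by (simp_all add: cofinal_seq_def)
  \<comment> \<open>If \<open>b\<close> equals a term of the sequence, the next term is strictly
    above it.\<close>
  have "\<exists>n. less lt M b (a n)" if "b \<in> univ M" for b using a(2,3) that by blast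
  with a sk sch lin model interpret inaccessible_structure fa pa lt M a
    by unfold_locales (simp_all add: countable_L lt_binary is_model_def)
  obtain C where C: "\<And>n. C n \<subseteq> U" "\<And>n. C (Suc n) \<subseteq> C n" "\<And>n b. b \<in> U \<Longrightarrow> \<exists>y\<in>C n. b \<sqsubset> y"
    "\<And>\<phi>. wf_fm fa pa \<phi> \<Longrightarrow> \<exists>k. \<forall>n\<ge>k. \<forall>x\<in>C n. \<forall>y\<in>C n. indisc lt M 0 \<phi> (a n) x y"
    using indiscernible_filter by blast
  interpret indiscernible_ultrapower fa pa lt M a C
    by unfold_locales (fact C)+
  have "elem_end_extension fa pa lt emb M N"
    unfolding elem_end_extension_def using emb_elementary end_extension emb_proper by blast
  moreover have "cof_omega lt N"
    using countable_cofinal_N cof_omega_if_countable_cofinal[OF linear_N no_max_N] by blast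
  ultimately show ?thesis using struc_N univ_N_eqpoll by blast
qed

end
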